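(* Let $G$ be a finite group, let $k\ge 1$ and $n\ge 0$ be integers, and let $C_1,\dots,C_n$ be not necessarily distinct conjugacy classes in $G$. Then $$\left|\{(g_1,\dots,g_k,c_1,\dots,c_n)\in G^k\times C_1\times\cdots\times C_n : g_1^2\cdots g_k^2\,c_1\cdots c_n=1\}\right| = |G|^{k-1}\,|C_1|\cdots|C_n|\sum_{\chi}\nu(\chi)^k\,\frac{\chi(C_1)\cdots\chi(C_n)}{\chi(1)^{n+k-2}},$$ where the sum is over the characters $\chi$ of the irreducible complex representations of $G$ and $\nu(\chi)$ denotes the Frobenius-Schur indicator of $\chi$.
   Context: All representations are over $\mathbb{C}$. For an irreducible character $\chi$ of $G$, the Frobenius-Schur indicator is $\nu(\chi)=\frac{1}{|G|}\sum_{g\in G}\chi(g^2)$. For a conjugacy class $C$ of $G$, $\chi(C)$ denotes the value of $\chi$ on any element of $C$. *)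

theory Defs
  imports
    "HOL-Algebra.Group_Action"
    "Jordan_Normal_Form.VS_Connect"
begin

definition general_linear_group :: "nat \<Rightarrow> complex mat monoid" where
  "general_linear_group d = units_of (ring_mat TYPE(complex) d ())"

definition mat_trace :: "'a::comm_monoid_add mat \<Rightarrow> 'a" where
  "mat_trace A = (\<Sum>i<dim_row A. A $$ (i, i))"

definition matrix_representation :: "('a, 'b) monoid_scheme \<Rightarrow> nat \<Rightarrow> ('a \<Rightarrow> complex mat) \<Rightarrow> bool" where
  "matrix_representation G d \<rho> \<longleftrightarrow> \<rho> \<in> hom G (general_linear_group d)"

definition invariant_subspace ::
    "('a, 'b) monoid_scheme \<Rightarrow> nat \<Rightarrow> ('a \<Rightarrow> complex mat) \<Rightarrow> complex vec set \<Rightarrow> bool" where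
  "invariant_subspace G d \<rho> W \<longleftrightarrow>
     VectorSpace.subspace class_ring W (module_vec TYPE(complex) d) \<and>
     (\<forall>g\<in>carrier G. \<forall>w\<in>W. \<rho> g *\<^sub>v w \<in> W)"

definition irreducible_representation ::
    "('a, 'b) monoid_scheme \<Rightarrow> nat \<Rightarrow> ('a \<Rightarrow> complex mat) \<Rightarrow> bool" where
  "irreducible_representation G d \<rho> \<longleftrightarrow>
     matrix_representation G d \<rho> \<and> d > 0 \<and>
     (\<forall>W. invariant_subspace G d \<rho> W \<longrightarrow> W = {0\<^sub>v d} \<or> W = carrier_vec d)"

text \<open>Characters are extensional (\<^const>\<open>undefined\<close> outside the carrier), so that characters agreeing
  on the group are equal and the set of irreducible characters contains each of them once.\<close>

definition character_of :: "('a, 'b) monoid_scheme \<Rightarrow> ('a \<Rightarrow> complex mat) \<Rightarrow> 'a \<Rightarrow> complex" where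
  "character_of G \<rho> = (\<lambda>g\<in>carrier G. mat_trace (\<rho> g))"

definition irreducible_characters :: "('a, 'b) monoid_scheme \<Rightarrow> ('a \<Rightarrow> complex) set" where
  "irreducible_characters G = {character_of G \<rho> | d \<rho>. irreducible_representation G d \<rho>}"

definition frobenius_schur_indicator :: "('a, 'b) monoid_scheme \<Rightarrow> ('a \<Rightarrow> complex) \<Rightarrow> complex" where
  "frobenius_schur_indicator G \<chi> =
     1 / of_nat (Coset.order G) * (\<Sum>g\<in>carrier G. \<chi> (g [^]\<^bsub>G\<^esub> (2::nat)))"

definition conjugacy_classes :: "('a, 'b) monoid_scheme \<Rightarrow> 'a set set" where
  "conjugacy_classes G =
     orbits G (carrier G) (\<lambda>g. \<lambda>h\<in>carrier G. g \<otimes>\<^bsub>G\<^esub> h \<otimes>\<^bsub>G\<^esub> inv\<^bsub>G\<^esub> g)"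

text \<open>The choice is immaterial: characters are constant on conjugacy classes.\<close>

definition class_value :: "('a \<Rightarrow> complex) \<Rightarrow> 'a set \<Rightarrow> complex" where
  "class_value \<chi> C = \<chi> (SOME g. g \<in> C)"

definition ordered_product :: "('a, 'b) monoid_scheme \<Rightarrow> 'a list \<Rightarrow> 'a" where
  "ordered_product G xs = foldr (\<otimes>\<^bsub>G\<^esub>) xs \<one>\<^bsub>G\<^esub>"

end

theory Submission
  imports Defs "Jordan_Normal_Form.Spectral_Radius"
begin

text \<open>
  If \<open>S\<close> is stable under conjugation and \<open>f\<close> commutes with conjugation, then the sum of
  \<open>\<rho> (f a)\<close> over \<open>a \<in> S\<close> commutes with an irreducible representation \<open>\<rho>\<close>, so by Schur's lemma it is
  a scalar, read off from its trace. Hence summing \<open>\<chi> (g\<^sub>1\<^sup>2 \<cdots> g\<^sub>k\<^sup>2 c\<^sub>1 \<cdots> c\<^sub>n)\<close> over all tuples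
  yields a factor \<open>|G| \<nu>(\<chi>) / \<chi>(1)\<close> for every square and \<open>|C| \<chi>(C) / \<chi>(1)\<close> for every class.
  The tuples with product \<open>1\<close> are selected by \<open>\<Sum>\<^sub>\<chi> \<chi>(1) \<chi>(g) = |G| [g = 1]\<close>: the character of the
  regular representation is a sum of irreducible characters, and orthogonality shows that each \<open>\<chi>\<close>
  occurs \<open>\<chi>(1)\<close> times. Orthogonality is used in the form \<open>\<Sum>\<^sub>g \<chi>(g) \<psi>(g\<^sup>-\<^sup>1)\<close>, which avoids unitarity,
  and the decomposition is obtained from block triangular matrices, which avoids Maschke's theorem.
\<close>

section \<open>Sums and traces of matrices\<close>

text \<open>Matrices of all sizes share one type, so an empty sum has no size of its own; the
  dimensions are therefore explicit arguments.\<close>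

definition matrix_sum :: "nat \<Rightarrow> nat \<Rightarrow> ('i \<Rightarrow> 'a::comm_monoid_add mat) \<Rightarrow> 'i set \<Rightarrow> 'a mat" where
  "matrix_sum n m f S = mat n m (\<lambda>(i, j). \<Sum>s\<in>S. f s $$ (i, j))"

lemma matrix_sum_carrier [simp]: "matrix_sum n m f S \<in> carrier_mat n m"
  and dim_matrix_sum [simp]: "dim_row (matrix_sum n m f S) = n" "dim_col (matrix_sum n m f S) = m"
  by (auto simp: matrix_sum_def)

lemma index_matrix_sum [simp]:
  "i < n \<Longrightarrow> j < m \<Longrightarrow> matrix_sum n m f S $$ (i, j) = (\<Sum>s\<in>S. f s $$ (i, j))"
  by (simp add: matrix_sum_def)

lemma matrix_sum_cong: "(\<And>s. s \<in> S \<Longrightarrow> f s = g s) \<Longrightarrow> matrix_sum n m f S = matrix_sum n m g S"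
  by (simp add: matrix_sum_def)

lemma matrix_sum_reindex:
  "inj_on h S \<Longrightarrow> matrix_sum n m f (h ` S) = matrix_sum n m (\<lambda>s. f (h s)) S"
  by (simp add: matrix_sum_def sum.reindex)

lemma index_mult_mat_sum:
  "A \<in> carrier_mat n m \<Longrightarrow> B \<in> carrier_mat m l \<Longrightarrow> i < n \<Longrightarrow> j < l \<Longrightarrow>
   (A * B) $$ (i, j) = (\<Sum>k<m. A $$ (i, k) * B $$ (k, j))"
  by (auto simp: scalar_prod_def atLeast0LessThan intro!: sum.cong)

lemma mult_matrix_sum:
  fixes A :: "'a::comm_ring_1 mat"
  assumes A: "A \<in> carrier_mat l n" and f: "\<And>s. s \<in> S \<Longrightarrow> f s \<in> carrier_mat n m"
  shows "A * matrix_sum n m f S = matrix_sum l m (\<lambda>s. A * f s) S"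
proof (rule eq_matI)
  fix i j assume "i < dim_row (matrix_sum l m (\<lambda>s. A * f s) S)" "j < dim_col (matrix_sum l m (\<lambda>s. A * f s) S)"
  then have ij: "i < l" "j < m" by auto
  have "(A * matrix_sum n m f S) $$ (i, j) = (\<Sum>k<n. \<Sum>s\<in>S. A $$ (i, k) * f s $$ (k, j))"
    using index_mult_mat_sum[OF A matrix_sum_carrier ij] ij by (simp add: sum_distrib_left)
  also have "\<dots> = (\<Sum>s\<in>S. \<Sum>k<n. A $$ (i, k) * f s $$ (k, j))" by (rule sum.swap)
  also have "\<dots> = (\<Sum>s\<in>S. (A * f s) $$ (i, j))"
    by (intro sum.cong refl index_mult_mat_sum[OF A _ ij, symmetric] f)
  finally show "(A * matrix_sum n m f S) $$ (i, j) = matrix_sum l m (\<lambda>s. A * f s) S $$ (i, j)"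
    using ij by simp
qed (use A in auto)

lemma matrix_sum_mult:
  fixes A :: "'a::comm_ring_1 mat"
  assumes A: "A \<in> carrier_mat m l" and f: "\<And>s. s \<in> S \<Longrightarrow> f s \<in> carrier_mat n m"
  shows "matrix_sum n m f S * A = matrix_sum n l (\<lambda>s. f s * A) S"
proof (rule eq_matI)
  fix i j assume "i < dim_row (matrix_sum n l (\<lambda>s. f s * A) S)" "j < dim_col (matrix_sum n l (\<lambda>s. f s * A) S)"
  then have ij: "i < n" "j < l" by auto
  have "(matrix_sum n m f S * A) $$ (i, j) = (\<Sum>k<m. \<Sum>s\<in>S. f s $$ (i, k) * A $$ (k, j))"
    using index_mult_mat_sum[OF matrix_sum_carrier A ij] ij by (simp add: sum_distrib_right)
  also have "\<dots> = (\<Sum>s\<in>S. \<Sum>k<m. f s $$ (i, k) * A $$ (k, j))" by (rule sum.swap)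
  also have "\<dots> = (\<Sum>s\<in>S. (f s * A) $$ (i, j))"
    by (intro sum.cong refl index_mult_mat_sum[OF _ A ij, symmetric] f)
  finally show "(matrix_sum n m f S * A) $$ (i, j) = matrix_sum n l (\<lambda>s. f s * A) S $$ (i, j)"
    using ij by simp
qed (use A in auto)

lemma mult_mat_unit_vec:
  fixes A :: "'a::comm_ring_1 mat"
  assumes "A \<in> carrier_mat n m" "i < m"
  shows "A *\<^sub>v unit_vec m i = col A i"
  using assms by (intro eq_vecI) auto

lemma mat_trace_carrier: "A \<in> carrier_mat n m \<Longrightarrow> mat_trace A = (\<Sum>i<n. A $$ (i, i))"
  by (simp add: mat_trace_def)

lemma mat_trace_matrix_sum:
  assumes "\<And>s. s \<in> S \<Longrightarrow> f s \<in> carrier_mat n n"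
  shows "mat_trace (matrix_sum n n f S) = (\<Sum>s\<in>S. mat_trace (f s))"
proof -
  have "mat_trace (matrix_sum n n f S) = (\<Sum>i<n. \<Sum>s\<in>S. f s $$ (i, i))"
    by (simp add: mat_trace_def)
  also have "\<dots> = (\<Sum>s\<in>S. \<Sum>i<n. f s $$ (i, i))" by (rule sum.swap)
  also have "\<dots> = (\<Sum>s\<in>S. mat_trace (f s))"
    by (intro sum.cong refl mat_trace_carrier[OF assms, symmetric])
  finally show ?thesis .
qed

lemma mat_trace_mult_commute:
  fixes A :: "'a::comm_ring_1 mat"
  assumes A: "A \<in> carrier_mat n m" and B: "B \<in> carrier_mat m n"
  shows "mat_trace (A * B) = mat_trace (B * A)"
proof -
  have "mat_trace (A * B) = (\<Sum>i<n. \<Sum>k<m. A $$ (i, k) * B $$ (k, i))"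
    using index_mult_mat_sum[OF A B] mat_trace_carrier[OF mult_carrier_mat[OF A B]] by simp
  also have "\<dots> = (\<Sum>k<m. \<Sum>i<n. B $$ (k, i) * A $$ (i, k))"
    by (subst sum.swap) (simp add: mult.commute)
  also have "\<dots> = mat_trace (B * A)"
    using index_mult_mat_sum[OF B A] mat_trace_carrier[OF mult_carrier_mat[OF B A]] by simp
  finally show ?thesis .
qed

lemma mat_trace_smult: "mat_trace (c \<cdot>\<^sub>m A) = c * mat_trace (A :: 'a::comm_ring_1 mat)" if "A \<in> carrier_mat n n"
  using that by (auto simp: mat_trace_def sum_distrib_left intro!: sum.cong)

lemma mat_trace_one: "mat_trace (1\<^sub>m n :: 'a::comm_ring_1 mat) = of_nat n"
  by (simp add: mat_trace_def)

section \<open>Matrix representations\<close>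

context group
begin

text \<open>Invertibility comes from the group: multiplicativity and the value at
  \<open>\<one>\<close> make \<open>\<rho> (inv g)\<close> a two-sided inverse of
  \<open>\<rho> g\<close>.\<close>

lemma matrix_representationI:
  assumes c: "\<And>g. g \<in> carrier G \<Longrightarrow> \<rho> g \<in> carrier_mat d d"
    and m: "\<And>g h. g \<in> carrier G \<Longrightarrow> h \<in> carrier G \<Longrightarrow> \<rho> (g \<otimes> h) = \<rho> g * \<rho> h"
    and o: "\<rho> \<one> = 1\<^sub>m d"
  shows "matrix_representation G d \<rho>"
proof -
  have "\<rho> g \<in> Units (ring_mat TYPE(complex) d ())" if g: "g \<in> carrier G" for g
    using m[of g "inv g"] m[of "inv g" g] c[of g] c[of "inv g"] o g
    by (auto simp: Units_def ring_mat_simps intro!: bexI[of _ "\<rho> (inv g)"])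
  then show ?thesis
    using m unfolding matrix_representation_def hom_def general_linear_group_def units_of_def
    by (auto simp: ring_mat_simps)
qed

lemma matrix_representationD:
  assumes "matrix_representation G d \<rho>"
  shows matrix_representation_carrier: "\<And>g. g \<in> carrier G \<Longrightarrow> \<rho> g \<in> carrier_mat d d"
    and matrix_representation_mult: "\<And>g h. g \<in> carrier G \<Longrightarrow> h \<in> carrier G \<Longrightarrow> \<rho> (g \<otimes> h) = \<rho> g * \<rho> h"
    and matrix_representation_one: "\<rho> \<one> = 1\<^sub>m d"
proof -
  let ?R = "ring_mat TYPE(complex) d ()"
  have h: "\<rho> \<in> hom G (units_of ?R)"
    using assms by (simp add: matrix_representation_def general_linear_group_def)
  have u: "\<rho> g \<in> Units ?R" if "g \<in> carrier G" for g
    using hom_in_carrier[OF h that] by (simp add: units_of_carrier)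
  show c: "\<rho> g \<in> carrier_mat d d" if "g \<in> carrier G" for g
    using u[OF that] by (auto simp: Units_def ring_mat_simps)
  show "\<rho> (g \<otimes> h') = \<rho> g * \<rho> h'" if "g \<in> carrier G" "h' \<in> carrier G" for g h'
    using hom_mult[OF h that] by (simp add: units_of_mult ring_mat_simps)
  interpret R: ring ?R by (rule ring_mat)
  interpret GL: group "units_of ?R" by (rule R.units_group)
  interpret group_hom G "units_of ?R" \<rho>
    by unfold_locales (rule h)
  show "\<rho> \<one> = 1\<^sub>m d"
    using hom_one by (simp add: units_of_one ring_mat_simps)
qed

end

lemma subspace_vecI:
  assumes "W \<subseteq> carrier_vec d" "0\<^sub>v d \<in> W"
    and "\<And>v w. v \<in> W \<Longrightarrow> w \<in> W \<Longrightarrow> v + w \<in> W" "\<And>c v. v \<in> W \<Longrightarrow> c \<cdot>\<^sub>v v \<in> W"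
  shows "VectorSpace.subspace class_ring W (module_vec TYPE('a::field) d)"
  using assms vec_vs[of d] vec_module[of d]
  by (auto simp: VectorSpace.subspace_def submodule_def module_vec_simps)

lemma subspace_vecD:
  assumes "VectorSpace.subspace class_ring W (module_vec TYPE('a::field) d)"
  shows "W \<subseteq> carrier_vec d" "0\<^sub>v d \<in> W"
    and "\<And>v w. v \<in> W \<Longrightarrow> w \<in> W \<Longrightarrow> v + w \<in> W" "\<And>c v. v \<in> W \<Longrightarrow> c \<cdot>\<^sub>v v \<in> W"
  using assms
  by (auto simp: VectorSpace.subspace_def submodule_def module_vec_simps)

section \<open>Schur's lemma\<close>

context group
begin

lemma irreducible_representationD:
  assumes "irreducible_representation G d \<rho>"
  shows irreducible_imp_representation: "matrix_representation G d \<rho>"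
    and irreducible_dim_pos: "d > 0"
    and irreducible_invariant_subspace:
      "\<And>W. W \<subseteq> carrier_vec d \<Longrightarrow> 0\<^sub>v d \<in> W \<Longrightarrow> (\<And>v w. v \<in> W \<Longrightarrow> w \<in> W \<Longrightarrow> v + w \<in> W) \<Longrightarrow>
        (\<And>c v. v \<in> W \<Longrightarrow> c \<cdot>\<^sub>v v \<in> W) \<Longrightarrow>
        (\<And>g w. g \<in> carrier G \<Longrightarrow> w \<in> W \<Longrightarrow> \<rho> g *\<^sub>v w \<in> W) \<Longrightarrow> W = {0\<^sub>v d} \<or> W = carrier_vec d"
  using assms subspace_vecI[of _ d]
  unfolding irreducible_representation_def invariant_subspace_def by blast+

text \<open>One half of Schur's lemma. The kernel of an intertwiner is stable under
  \<open>\<rho>\<close>, so irreducibility leaves only zero or the whole space; in the latter case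
  every column of \<open>T\<close>, being the image of a unit vector, would vanish.\<close>

lemma intertwiner_kernel:
  assumes irr: "irreducible_representation G d \<rho>"
    and \<sigma>: "\<And>g. g \<in> carrier G \<Longrightarrow> \<sigma> g \<in> carrier_mat e e"
    and T: "T \<in> carrier_mat e d" "T \<noteq> 0\<^sub>m e d"
    and TT: "\<And>g. g \<in> carrier G \<Longrightarrow> \<sigma> g * T = T * \<rho> g"
    and v: "v \<in> carrier_vec d" "T *\<^sub>v v = 0\<^sub>v e"
  shows "v = 0\<^sub>v d"
proof -
  let ?W = "{v \<in> carrier_vec d. T *\<^sub>v v = 0\<^sub>v e}"
  note \<rho> = matrix_representation_carrier[OF irreducible_imp_representation[OF irr]]
  have "?W = {0\<^sub>v d} \<or> ?W = carrier_vec d"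
  proof (rule irreducible_invariant_subspace[OF irr])
    show "\<rho> g *\<^sub>v w \<in> ?W" if g: "g \<in> carrier G" and w: "w \<in> ?W" for g w
    proof -
      have "T *\<^sub>v (\<rho> g *\<^sub>v w) = \<sigma> g *\<^sub>v (T *\<^sub>v w)"
        using assoc_mult_mat_vec[OF \<sigma>[OF g] T(1)] assoc_mult_mat_vec[OF T(1) \<rho>[OF g]] w TT[OF g]
        by simp
      then show ?thesis using w \<rho>[OF g] \<sigma>[OF g] by auto
    qed
  qed (use T in \<open>auto simp: mult_add_distrib_mat_vec mult_mat_vec\<close>)
  moreover have "?W \<noteq> carrier_vec d"
  proof
    assume W: "?W = carrier_vec d"
    have "T = 0\<^sub>m e d"
    proof (rule eq_matI)
      fix i j assume "i < dim_row (0\<^sub>m e d)" "j < dim_col (0\<^sub>m e d)"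
      then have ij: "i < e" "j < d" by auto
      have "T *\<^sub>v unit_vec d j = 0\<^sub>v e" using W unit_vec_carrier by blast
      then have "col T j = 0\<^sub>v e"
        using mult_mat_unit_vec[OF T(1) ij(2)] by simp
      then show "T $$ (i, j) = 0\<^sub>m e d $$ (i, j)"
        using ij T by (metis carrier_matD index_col index_zero_mat(1) index_zero_vec(1))
    qed (use T in auto)
    then show False using T by simp
  qed
  ultimately show ?thesis using v by blast
qed

text \<open>Over the complex numbers \<open>T\<close> has an eigenvalue \<open>c\<close>. The matrix
  \<open>T - c \<cdot>\<^sub>m 1\<^sub>m d\<close> still commutes with \<open>\<rho>\<close> but
  kills an eigenvector, so by the statement on kernels it is zero.\<close>

lemma schur_scalar:
  assumes irr: "irreducible_representation G d \<rho>"
    and T: "T \<in> carrier_mat d d"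
    and TT: "\<And>g. g \<in> carrier G \<Longrightarrow> \<rho> g * T = T * \<rho> g"
  shows "T = (mat_trace T / of_nat d) \<cdot>\<^sub>m 1\<^sub>m d"
proof -
  note \<rho> = matrix_representation_carrier[OF irreducible_imp_representation[OF irr]]
  have d: "d > 0" by (rule irreducible_dim_pos[OF irr])
  obtain c where "eigenvalue T c"
    using spectrum_non_empty[OF T d] by (auto simp: spectrum_def)
  then obtain v where v: "v \<in> carrier_vec d" "v \<noteq> 0\<^sub>v d" "T *\<^sub>v v = c \<cdot>\<^sub>v v"
    using T by (auto simp: eigenvalue_def eigenvector_def)
  let ?T = "T - c \<cdot>\<^sub>m 1\<^sub>m d"
  have "?T *\<^sub>v v = T *\<^sub>v v - (c \<cdot>\<^sub>m 1\<^sub>m d) *\<^sub>v v"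
    using T v by (intro minus_mult_distrib_mat_vec) auto
  also have "(c \<cdot>\<^sub>m 1\<^sub>m d) *\<^sub>v v = c \<cdot>\<^sub>v v"
    using v by (intro eq_vecI) (auto simp: row_smult)
  finally have ker: "?T *\<^sub>v v = 0\<^sub>v d"
    using v by simp
  have "?T = 0\<^sub>m d d"
  proof (rule ccontr)
    assume nz: "?T \<noteq> 0\<^sub>m d d"
    have comm: "\<rho> g * ?T = ?T * \<rho> g" if g: "g \<in> carrier G" for g
    proof -
      have "\<rho> g * ?T = \<rho> g * T - \<rho> g * (c \<cdot>\<^sub>m 1\<^sub>m d)"
        using \<rho>[OF g] T by (intro mult_minus_distrib_mat) auto
      also have "\<rho> g * (c \<cdot>\<^sub>m 1\<^sub>m d) = (c \<cdot>\<^sub>m 1\<^sub>m d) * \<rho> g"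
        using \<rho>[OF g] mult_smult_distrib[OF \<rho>[OF g], of "1\<^sub>m d" d c] mult_smult_assoc_mat[of "1\<^sub>m d" d d "\<rho> g" d c] by simp
      also have "\<rho> g * T - (c \<cdot>\<^sub>m 1\<^sub>m d) * \<rho> g = ?T * \<rho> g"
        using \<rho>[OF g] T TT[OF g] by (subst minus_mult_distrib_mat[of _ d d]) auto
      finally show ?thesis .
    qed
    have "?T \<in> carrier_mat d d" by (intro minus_carrier_mat smult_carrier_mat one_carrier_mat)
    from intertwiner_kernel[OF irr \<rho> this nz comm v(1) ker] have "v = 0\<^sub>v d" .
    with v show False by simp
  qed
  then have "T = c \<cdot>\<^sub>m 1\<^sub>m d"
    using T by (auto simp: mat_eq_iff)
  \<comment> \<open>Taking traces gives \<open>mat_trace T\<close> as \<open>c\<close> times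
    \<open>d\<close>, which determines \<open>c\<close> because \<open>d > 0\<close>.\<close>
  then show ?thesis
    using d by (simp add: mat_trace_smult[of _ d] mat_trace_one)
qed

text \<open>The other half of Schur's lemma: kernel and image of \<open>T\<close> are both
  invariant, so \<open>T\<close> is bijective and the two representations are conjugate. An explicit
  two-sided inverse \<open>S\<close> serves in place of a comparison of \<open>d\<close> with
  \<open>e\<close>.\<close>

lemma irreducible_intertwiner_trace:
  assumes irr: "irreducible_representation G d \<rho>" "irreducible_representation G e \<sigma>"
    and T: "T \<in> carrier_mat e d" "T \<noteq> 0\<^sub>m e d"
    and TT: "\<And>g. g \<in> carrier G \<Longrightarrow> \<sigma> g * T = T * \<rho> g"
    and g: "g \<in> carrier G"
  shows "mat_trace (\<sigma> g) = mat_trace (\<rho> g)"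
proof -
  note \<rho> = matrix_representation_carrier[OF irreducible_imp_representation[OF irr(1)]]
  note \<sigma> = matrix_representation_carrier[OF irreducible_imp_representation[OF irr(2)]]
  note ker = intertwiner_kernel[OF irr(1) \<sigma> T TT]
  let ?W = "(\<lambda>v. T *\<^sub>v v) ` carrier_vec d"
  have "?W = {0\<^sub>v e} \<or> ?W = carrier_vec e"
  proof (rule irreducible_invariant_subspace[OF irr(2)])
    have "T *\<^sub>v 0\<^sub>v d = 0\<^sub>v e" using T by auto
    then show "0\<^sub>v e \<in> ?W" by (metis image_eqI zero_carrier_vec)
    show "v + w \<in> ?W" if vw: "v \<in> ?W" "w \<in> ?W" for v w
    proof -
      obtain v' w' where "v = T *\<^sub>v v'" "w = T *\<^sub>v w'" "v' \<in> carrier_vec d" "w' \<in> carrier_vec d"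
        using vw by auto
      then show ?thesis using T by (intro image_eqI[of _ _ "v' + w'"]) (auto simp: mult_add_distrib_mat_vec)
    qed
    show "c \<cdot>\<^sub>v v \<in> ?W" if v: "v \<in> ?W" for c v
    proof -
      obtain v' where "v = T *\<^sub>v v'" "v' \<in> carrier_vec d" using v by auto
      then show ?thesis using T by (intro image_eqI[of _ _ "c \<cdot>\<^sub>v v'"]) (auto simp: mult_mat_vec)
    qed
    show "\<sigma> g *\<^sub>v w \<in> ?W" if g: "g \<in> carrier G" and w: "w \<in> ?W" for g w
    proof -
      obtain v where v: "w = T *\<^sub>v v" "v \<in> carrier_vec d" using w by auto
      have "\<sigma> g *\<^sub>v w = T *\<^sub>v (\<rho> g *\<^sub>v v)"
        using assoc_mult_mat_vec[OF \<sigma>[OF g] T(1) v(2)] assoc_mult_mat_vec[OF T(1) \<rho>[OF g] v(2)] v TT[OF g]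
        by simp
      then show ?thesis using \<rho>[OF g] v by auto
    qed
  qed (use T in auto)
  \<comment> \<open>A zero image would put the first unit vector into the kernel; this vector exists
    and is nonzero because \<open>d > 0\<close>.\<close>
  moreover have "?W \<noteq> {0\<^sub>v e}"
  proof
    assume "?W = {0\<^sub>v e}"
    then have "T *\<^sub>v unit_vec d 0 = 0\<^sub>v e" by (metis image_eqI singletonD unit_vec_carrier)
    then have "unit_vec d 0 = (0\<^sub>v d :: complex vec)" by (intro ker) auto
    then show False using irreducible_dim_pos[OF irr(1)] by (metis index_unit_vec(1) index_zero_vec(1) zero_neq_one)
  qed
  ultimately have surj: "?W = carrier_vec e" by blast
  have "\<forall>i. \<exists>v\<in>carrier_vec d. T *\<^sub>v v = unit_vec e i"
    using surj unit_vec_carrier by (metis (no_types, lifting) imageE)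
  then obtain f where f: "\<And>i. f i \<in> carrier_vec d" "\<And>i. T *\<^sub>v f i = unit_vec e i" by metis
  \<comment> \<open>The columns of \<open>S\<close> are chosen preimages of the unit vectors, which
    makes \<open>S\<close> a right inverse of \<open>T\<close>.\<close>
  define S where "S = mat_of_cols d (map f [0..<e])"
  have S: "S \<in> carrier_mat d e" by (auto simp: S_def)
  have colS: "col S i = f i" if "i < e" for i
    unfolding S_def using that f by (subst col_mat_of_cols) auto
  have TS: "T * S = 1\<^sub>m e"
  proof (rule mat_col_eqI)
    fix i assume "i < dim_col (1\<^sub>m e)"
    then have i: "i < e" by simp
    have "col (T * S) i = T *\<^sub>v col S i" using T S i by (intro col_mult2) auto
    then show "col (T * S) i = col (1\<^sub>m e) i" using i colS f by simp
  qed (use T S in auto)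
  have ST: "S * T = 1\<^sub>m d"
  proof (rule mat_col_eqI)
    fix i assume "i < dim_col (1\<^sub>m d)"
    then have i: "i < d" by simp
    \<comment> \<open>Since \<open>T * (S * T) = T\<close>, the matrix \<open>T\<close> maps this
      difference to zero, and injectivity makes it vanish: the right inverse is also a left
      inverse.\<close>
    let ?v = "col (S * T) i - unit_vec d i"
    have c: "col (S * T) i \<in> carrier_vec d"
      by (rule col_carrier_vec[OF i mult_carrier_mat[OF S T(1)]])
    have "T *\<^sub>v ?v = T *\<^sub>v col (S * T) i - T *\<^sub>v unit_vec d i"
      using T c by (intro mult_minus_distrib_mat_vec) auto
    also have "T *\<^sub>v col (S * T) i = col (T * (S * T)) i"
      using T S i by (subst col_mult2[of T e d]) auto
    also have "T * (S * T) = T" using TS T assoc_mult_mat[OF T(1) S T(1)] by simp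
    also have "col T i - T *\<^sub>v unit_vec d i = 0\<^sub>v e"
      using col_carrier_vec[OF i T(1)] mult_mat_unit_vec[OF T(1) i] by simp
    finally have "?v = 0\<^sub>v d" using c by (intro ker) auto
    then show "col (S * T) i = col (1\<^sub>m d) i" using c i S by (auto simp: vec_eq_iff)
  qed (use T S in auto)
  \<comment> \<open>Here \<open>\<sigma> g\<close> becomes \<open>T * \<rho> g * S\<close>, a
    conjugate of \<open>\<rho> g\<close>; moving \<open>S\<close> to the front under the trace
    cancels it against \<open>T\<close>.\<close>
  have "mat_trace (\<sigma> g) = mat_trace (\<sigma> g * (T * S))" using TS \<sigma>[OF g] by simp
  also have "\<sigma> g * (T * S) = (T * \<rho> g) * S"
    using TT[OF g] assoc_mult_mat[OF \<sigma>[OF g] T(1) S] by simp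
  also have "mat_trace \<dots> = mat_trace (S * (T * \<rho> g))"
    using T S \<rho>[OF g] by (intro mat_trace_mult_commute[of _ e d]) auto
  also have "S * (T * \<rho> g) = \<rho> g" using ST assoc_mult_mat[OF S T(1) \<rho>[OF g]] \<rho>[OF g] by simp
  finally show ?thesis .
qed

end

section \<open>Decomposition of characters\<close>

context vec_space
begin

text \<open>A vector of \<open>W\<close> outside \<open>span B\<close> could be adjoined to
  \<open>B\<close> without losing independence, against maximality.\<close>

lemma maximal_lin_indpt_span:
  assumes W: "VectorSpace.subspace class_ring W V"
    and B: "maximal B (\<lambda>S. S \<subseteq> W \<and> lin_indpt S)"
  shows "span B = W"
proof
  have WV: "W \<subseteq> carrier_vec n" by (rule subspace_vecD(1)[OF W])
  have BW: "B \<subseteq> W" "lin_indpt B" using B by (auto simp: maximal_def)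
  show "span B \<subseteq> W" by (rule span_is_subset[OF BW(1) is_module[OF W]])
  show "W \<subseteq> span B"
  proof
    fix w assume w: "w \<in> W"
    show "w \<in> span B"
    proof (rule ccontr)
      assume n: "w \<notin> span B"
      have "B \<subseteq> carrier_vec n" "w \<in> carrier_vec n" using BW WV w by auto
      then have "w \<notin> B" using n in_own_span by blast
      then have "lin_indpt (B \<union> {w})"
        using lin_dep_iff_in_span[OF \<open>B \<subseteq> carrier_vec n\<close> BW(2) \<open>w \<in> carrier_vec n\<close>] n by simp
      then have "B \<union> {w} = B"
        using B BW(1) w unfolding maximal_def by (metis Un_upper1 Un_subset_iff empty_subsetI insert_subset)
      with \<open>w \<notin> B\<close> show False by blast
    qed
  qed
qed

text \<open>A basis of \<open>W\<close> is extended to a basis of the whole space. The columns of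
  \<open>P\<close> are this basis with the vectors from \<open>W\<close> first, \<open>m\<close> is
  the dimension of \<open>W\<close>, and \<open>Q *\<^sub>v w\<close> is the coordinate vector of
  \<open>w\<close>.\<close>

lemma adapted_basis:
  assumes W: "VectorSpace.subspace class_ring W V" and nontriv: "W \<noteq> {0\<^sub>v n}" "W \<noteq> carrier_vec n"
  obtains P Q m where "P \<in> carrier_mat n n" "Q \<in> carrier_mat n n" "P * Q = 1\<^sub>m n" "Q * P = 1\<^sub>m n"
    "0 < m" "m < n" "\<And>j. j < m \<Longrightarrow> col P j \<in> W"
    "\<And>w i. w \<in> W \<Longrightarrow> m \<le> i \<Longrightarrow> i < n \<Longrightarrow> (Q *\<^sub>v w) $ i = 0"
proof -
  have WV: "W \<subseteq> carrier_vec n" by (rule subspace_vecD(1)[OF W])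
  \<comment> \<open>This bound on the size of independent sets makes the maximal sets
    \<open>B\<close> and \<open>C\<close> below exist.\<close>
  have bound: "finite S \<and> card S \<le> n" if "S \<subseteq> carrier_vec n \<and> lin_indpt S" for S
    using li_le_dim[OF fin_dim, of S] that by (simp add: dim_is_n)
  have empty: "lin_indpt {}" by (metis basis_def empty_subsetI finite_basis_exists fin_dim subset_li_is_li)
  obtain B where B: "finite B" "maximal B (\<lambda>S. S \<subseteq> W \<and> lin_indpt S)"
    using maximal_exists[of "\<lambda>S. S \<subseteq> W \<and> lin_indpt S" n "{}", OF bound] WV empty by auto
  have BW: "B \<subseteq> W" "lin_indpt B" using B(2) by (auto simp: maximal_def)
  have spanB: "span B = W" by (rule maximal_lin_indpt_span[OF W B(2)])
  obtain C where C: "finite C" "maximal C (\<lambda>S. B \<subseteq> S \<and> S \<subseteq> carrier_vec n \<and> lin_indpt S)"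
    using maximal_exists[of "\<lambda>S. B \<subseteq> S \<and> S \<subseteq> carrier_vec n \<and> lin_indpt S" n B, OF bound] BW WV by (meson order.trans order_refl)
  have BC: "B \<subseteq> C" "C \<subseteq> carrier_vec n" "lin_indpt C" using C(2) unfolding maximal_def by blast+
  \<comment> \<open>Any independent set containing \<open>C\<close> also contains \<open>B\<close>,
    so maximality among the extensions of \<open>B\<close> is maximality among all independent
    sets.\<close>
  have "maximal C (\<lambda>S. S \<subseteq> carrier_vec n \<and> lin_indpt S)"
    unfolding maximal_def
  proof (intro conjI allI impI)
    fix S assume S: "C \<subseteq> S \<and> S \<subseteq> carrier_vec n \<and> lin_indpt S"
    then have "B \<subseteq> S" using BC(1) by blast
    with S show "S = C" using C(2) unfolding maximal_def by blast
  qed (rule BC)+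
  then have basis: "basis C" by (rule max_li_is_basis)
  have cardC: "card C = n" using dim_basis[OF C(1) basis] dim_is_n by simp
  have spanC: "span C = carrier_vec n" using basis by (simp add: basis_def)
  obtain bs where bs: "set bs = B" "distinct bs" using finite_distinct_list[OF B(1)] by blast
  obtain cs where cs: "set cs = C - B" "distinct cs" using finite_distinct_list[of "C - B"] C(1) by blast
  define ws where "ws = bs @ cs"
  define m where "m = length bs"
  define P where "P = mat_of_cols n ws"
  have ws: "set ws = C" "distinct ws" using bs cs BC by (auto simp: ws_def)
  then have len: "length ws = n" using cardC distinct_card by metis
  have P: "P \<in> carrier_mat n n" by (auto simp: P_def len)
  have wsV: "set ws \<subseteq> carrier_vec n" using ws BC by simp
  have colP: "col P j = ws ! j" if "j < n" for j
    unfolding P_def using that len wsV by (intro col_mat_of_cols) (auto dest: nth_mem)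
  \<comment> \<open>Since \<open>C\<close> spans, every vector is a combination of the columns of
    \<open>P\<close>; preimages of the unit vectors then form the columns of
    \<open>Q\<close>.\<close>
  have ex: "\<exists>v\<in>carrier_vec n. P *\<^sub>v v = w" if "w \<in> carrier_vec n" for w
  proof -
    have "w \<in> span_list ws" using span_list_as_span[OF wsV] ws(1) spanC that by simp
    then obtain c where "w = lincomb_list c ws" by (auto simp: span_list_def)
    moreover have "\<forall>w\<in>set ws. dim_vec w = n" using wsV by auto
    ultimately have "w = P *\<^sub>v vec n c"
      using lincomb_list_as_mat_mult[of ws c] len by (simp add: P_def)
    then show ?thesis by (intro bexI[of _ "vec n c"]) auto
  qed
  then have "\<forall>i. \<exists>v\<in>carrier_vec n. P *\<^sub>v v = unit_vec n i" by (intro allI ex) simp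
  then obtain f where f: "\<And>i. f i \<in> carrier_vec n" "\<And>i. P *\<^sub>v f i = unit_vec n i" by metis
  define Q where "Q = mat_of_cols n (map f [0..<n])"
  have Q: "Q \<in> carrier_mat n n" by (auto simp: Q_def)
  have colQ: "col Q i = f i" if "i < n" for i
    unfolding Q_def using that f by (subst col_mat_of_cols) auto
  have PQ: "P * Q = 1\<^sub>m n"
  proof (rule mat_col_eqI)
    fix i assume "i < dim_col (1\<^sub>m n)"
    then have i: "i < n" by simp
    show "col (P * Q) i = col (1\<^sub>m n) i" using col_mult2[OF P Q i] i colQ f by simp
  qed (use P Q in auto)
  have QP: "Q * P = 1\<^sub>m n" by (rule mat_mult_left_right_inverse[OF P Q PQ])
  have mB: "m = card B" using distinct_card[OF bs(2)] bs(1) by (simp add: m_def)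
  have "0 < m"
  proof (rule ccontr)
    assume "\<not> 0 < m"
    then have "B = {}" using mB B(1) by simp
    then show False using spanB nontriv span_empty by simp
  qed
  moreover have "m < n"
  proof -
    have "B \<noteq> C" using spanB spanC nontriv by auto
    then show ?thesis using mB cardC BC C(1) by (metis psubsetI psubset_card_mono)
  qed
  moreover have colW: "col P j \<in> W" if "j < m" for j
    using colP[of j] that \<open>m < n\<close> BW bs by (auto simp: ws_def nth_append m_def)
  moreover have "(Q *\<^sub>v w) $ i = 0" if w: "w \<in> W" and i: "m \<le> i" "i < n" for w i
  proof -
    \<comment> \<open>Vanishing of a fixed coordinate \<open>i \<ge> m\<close> defines a subspace.
      It contains the basis \<open>B\<close> of \<open>W\<close>, whose coordinate vectors are unit
      vectors with index below \<open>m\<close>, and hence all of \<open>W\<close>.\<close>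
    let ?K = "{w \<in> carrier_vec n. (Q *\<^sub>v w) $ i = 0}"
    have K: "VectorSpace.subspace class_ring ?K V"
      using Q i by (intro subspace_vecI) (auto simp: mult_add_distrib_mat_vec mult_mat_vec scalar_prod_add_distrib[of _ n])
    have "B \<subseteq> ?K"
    proof
      fix b assume b: "b \<in> B"
      then obtain j where j: "j < m" "bs ! j = b" using bs by (auto simp: in_set_conv_nth m_def)
      then have bj: "b = col P j" using colP[of j] \<open>m < n\<close> by (simp add: ws_def nth_append m_def)
      have "Q *\<^sub>v b = unit_vec n j"
        using col_mult2[OF Q P, of j] QP j \<open>m < n\<close> bj by simp
      then show "b \<in> ?K" using b BW WV i j by auto
    qed
    then have "span B \<subseteq> ?K" by (rule span_is_subset[OF _ is_module[OF K]])
    then show ?thesis using w spanB by auto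
  qed
  ultimately show thesis using that P Q PQ QP by blast
qed

end

lemma sum_lessThan_add:
  "(\<Sum>k<m + r. f k) = (\<Sum>k<m. f k) + (\<Sum>k<r. f (m + k :: nat) :: 'a::comm_monoid_add)"
  by (induction r) (simp_all add: add.assoc)

section \<open>Block triangular form and irreducible constituents\<close>

context group
begin

lemma conjugate_representation:
  assumes \<rho>: "matrix_representation G d \<rho>"
    and P: "P \<in> carrier_mat d d" and Q: "Q \<in> carrier_mat d d" and PQ: "P * Q = 1\<^sub>m d" and QP: "Q * P = 1\<^sub>m d"
  shows "matrix_representation G d (\<lambda>g. Q * (\<rho> g * P))"
    and "\<And>g. g \<in> carrier G \<Longrightarrow> mat_trace (Q * (\<rho> g * P)) = mat_trace (\<rho> g)"
proof -
  note c = matrix_representation_carrier[OF \<rho>]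
  show "matrix_representation G d (\<lambda>g. Q * (\<rho> g * P))"
  proof (rule matrix_representationI)
    fix g h assume g: "g \<in> carrier G" and h: "h \<in> carrier G"
    have "(Q * (\<rho> g * P)) * (Q * (\<rho> h * P)) = Q * (\<rho> g * ((P * Q) * (\<rho> h * P)))"
      using P Q c[OF g] c[OF h] by (simp add: assoc_mult_mat[of _ d d _ d _ d])
    also have "\<dots> = Q * (\<rho> (g \<otimes> h) * P)"
      using P c[OF g] c[OF h]
      by (simp add: PQ matrix_representation_mult[OF \<rho> g h] assoc_mult_mat[of _ d d _ d _ d])
    finally show "Q * (\<rho> (g \<otimes> h) * P) = (Q * (\<rho> g * P)) * (Q * (\<rho> h * P))" ..
  qed (use P Q QP c matrix_representation_one[OF \<rho>] in auto)
  show "mat_trace (Q * (\<rho> g * P)) = mat_trace (\<rho> g)" if g: "g \<in> carrier G" for g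
  proof -
    have "mat_trace (Q * (\<rho> g * P)) = mat_trace ((\<rho> g * P) * Q)"
      using P Q c[OF g] by (intro mat_trace_mult_commute[of _ d d]) auto
    also have "(\<rho> g * P) * Q = \<rho> g"
      using assoc_mult_mat[OF c[OF g] P Q] PQ c[OF g] by simp
    finally show ?thesis .
  qed
qed

text \<open>With a zero lower left block the diagonal blocks multiply independently. They describe
  the action on an invariant subspace and on the quotient by it.\<close>

lemma block_triangular_representation:
  assumes \<rho>: "matrix_representation G (m + r) \<rho>"
    and zero: "\<And>g i j. g \<in> carrier G \<Longrightarrow> i < r \<Longrightarrow> j < m \<Longrightarrow> \<rho> g $$ (m + i, j) = 0"
  obtains \<rho>\<^sub>1 \<rho>\<^sub>2 where "matrix_representation G m \<rho>\<^sub>1" "matrix_representation G r \<rho>\<^sub>2"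
    "\<And>g. g \<in> carrier G \<Longrightarrow> mat_trace (\<rho> g) = mat_trace (\<rho>\<^sub>1 g) + mat_trace (\<rho>\<^sub>2 g)"
proof -
  define \<rho>\<^sub>1 where "\<rho>\<^sub>1 g = mat m m (\<lambda>(i, j). \<rho> g $$ (i, j))" for g
  define \<rho>\<^sub>2 where "\<rho>\<^sub>2 g = mat r r (\<lambda>(i, j). \<rho> g $$ (m + i, m + j))" for g
  note c = matrix_representation_carrier[OF \<rho>]
  \<comment> \<open>The inner sum of the matrix product is cut at \<open>m\<close>. The zero block
    kills the second part for the upper left block and the first part for the lower right
    one.\<close>
  have mult: "\<rho> (g \<otimes> h) $$ (i, j) =
      (\<Sum>k<m. \<rho> g $$ (i, k) * \<rho> h $$ (k, j)) + (\<Sum>k<r. \<rho> g $$ (i, m + k) * \<rho> h $$ (m + k, j))"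
    if "g \<in> carrier G" "h \<in> carrier G" "i < m + r" "j < m + r" for g h i j
    using index_mult_mat_sum[OF c c, of g h i j] that
    by (simp add: matrix_representation_mult[OF \<rho>] sum_lessThan_add)
  have "matrix_representation G m \<rho>\<^sub>1"
  proof (rule matrix_representationI)
    fix g h assume gh: "g \<in> carrier G" "h \<in> carrier G"
    show "\<rho>\<^sub>1 (g \<otimes> h) = \<rho>\<^sub>1 g * \<rho>\<^sub>1 h"
    proof (rule eq_matI)
      fix i j assume "i < dim_row (\<rho>\<^sub>1 g * \<rho>\<^sub>1 h)" "j < dim_col (\<rho>\<^sub>1 g * \<rho>\<^sub>1 h)"
      then have "i < m" "j < m" by (auto simp: \<rho>\<^sub>1_def)
      then show "\<rho>\<^sub>1 (g \<otimes> h) $$ (i, j) = (\<rho>\<^sub>1 g * \<rho>\<^sub>1 h) $$ (i, j)"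
        using mult[OF gh, of i j] gh zero index_mult_mat_sum[of "\<rho>\<^sub>1 g" m m "\<rho>\<^sub>1 h" m i j]
        by (simp add: \<rho>\<^sub>1_def)
    qed (auto simp: \<rho>\<^sub>1_def)
  qed (auto simp: \<rho>\<^sub>1_def matrix_representation_one[OF \<rho>] intro!: eq_matI)
  moreover have "matrix_representation G r \<rho>\<^sub>2"
  proof (rule matrix_representationI)
    fix g h assume gh: "g \<in> carrier G" "h \<in> carrier G"
    show "\<rho>\<^sub>2 (g \<otimes> h) = \<rho>\<^sub>2 g * \<rho>\<^sub>2 h"
    proof (rule eq_matI)
      fix i j assume "i < dim_row (\<rho>\<^sub>2 g * \<rho>\<^sub>2 h)" "j < dim_col (\<rho>\<^sub>2 g * \<rho>\<^sub>2 h)"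
      then have "i < r" "j < r" by (auto simp: \<rho>\<^sub>2_def)
      then show "\<rho>\<^sub>2 (g \<otimes> h) $$ (i, j) = (\<rho>\<^sub>2 g * \<rho>\<^sub>2 h) $$ (i, j)"
        using mult[OF gh, of "m + i" "m + j"] gh zero index_mult_mat_sum[of "\<rho>\<^sub>2 g" r r "\<rho>\<^sub>2 h" r i j]
        by (simp add: \<rho>\<^sub>2_def)
    qed (auto simp: \<rho>\<^sub>2_def)
  qed (auto simp: \<rho>\<^sub>2_def matrix_representation_one[OF \<rho>] intro!: eq_matI)
  moreover have "mat_trace (\<rho> g) = mat_trace (\<rho>\<^sub>1 g) + mat_trace (\<rho>\<^sub>2 g)" if "g \<in> carrier G" for g
    using mat_trace_carrier[OF c[OF that]] by (simp add: sum_lessThan_add \<rho>\<^sub>1_def \<rho>\<^sub>2_def mat_trace_def)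
  ultimately show thesis by (rule that)
qed

text \<open>In a basis adapted to a proper nonzero invariant subspace all matrices become block
  triangular at once. Both blocks are smaller than \<open>d\<close> because \<open>0 < m\<close> and
  \<open>m < d\<close>, which permits induction on the dimension.\<close>

lemma reducible_representation:
  assumes \<rho>: "matrix_representation G d \<rho>" and d: "d > 0" and red: "\<not> irreducible_representation G d \<rho>"
  obtains m r \<rho>\<^sub>1 \<rho>\<^sub>2 where "m < d" "r < d" "matrix_representation G m \<rho>\<^sub>1" "matrix_representation G r \<rho>\<^sub>2"
    "\<And>g. g \<in> carrier G \<Longrightarrow> mat_trace (\<rho> g) = mat_trace (\<rho>\<^sub>1 g) + mat_trace (\<rho>\<^sub>2 g)"
proof -
  interpret vec_space "TYPE(complex)" d .
  note c = matrix_representation_carrier[OF \<rho>]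
  obtain W where W: "VectorSpace.subspace class_ring W V" "W \<noteq> {0\<^sub>v d}" "W \<noteq> carrier_vec d"
    and inv: "\<And>g w. g \<in> carrier G \<Longrightarrow> w \<in> W \<Longrightarrow> \<rho> g *\<^sub>v w \<in> W"
    using red \<rho> d unfolding irreducible_representation_def invariant_subspace_def by blast
  obtain P Q m where PQ: "P \<in> carrier_mat d d" "Q \<in> carrier_mat d d" "P * Q = 1\<^sub>m d" "Q * P = 1\<^sub>m d"
    and m: "0 < m" "m < d" and colP: "\<And>j. j < m \<Longrightarrow> col P j \<in> W"
    and QW: "\<And>w i. w \<in> W \<Longrightarrow> m \<le> i \<Longrightarrow> i < d \<Longrightarrow> (Q *\<^sub>v w) $ i = 0"
    using adapted_basis[OF W] by metis
  define r where "r = d - m"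
  have d_eq: "d = m + r" and "r < d" using m by (auto simp: r_def)
  let ?\<sigma> = "\<lambda>g. Q * (\<rho> g * P)"
  note \<sigma> = conjugate_representation[OF \<rho> PQ]
  have "?\<sigma> g $$ (m + i, j) = 0" if g: "g \<in> carrier G" and ij: "i < r" "j < m" for g i j
  proof -
    have j: "j < d" using ij m by simp
    \<comment> \<open>Column \<open>j\<close> holds the coordinates of the image of a basis vector
      from \<open>W\<close>; the image stays in \<open>W\<close>, so its coordinates from
      \<open>m\<close> on vanish.\<close>
    have "?\<sigma> g $$ (m + i, j) = col (?\<sigma> g) j $ (m + i)"
      using PQ c[OF g] ij d_eq by simp
    also have "col (?\<sigma> g) j = Q *\<^sub>v (\<rho> g *\<^sub>v col P j)"
      using col_mult2[OF PQ(2) mult_carrier_mat[OF c[OF g] PQ(1)] j] col_mult2[OF c[OF g] PQ(1) j] by simp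
    finally show ?thesis using QW[OF inv[OF g colP], of j "m + i"] ij d_eq by simp
  qed
  then obtain \<rho>\<^sub>1 \<rho>\<^sub>2 where "matrix_representation G m \<rho>\<^sub>1" "matrix_representation G r \<rho>\<^sub>2"
    "\<And>g. g \<in> carrier G \<Longrightarrow> mat_trace (?\<sigma> g) = mat_trace (\<rho>\<^sub>1 g) + mat_trace (\<rho>\<^sub>2 g)"
    using block_triangular_representation[of m r ?\<sigma>] \<sigma>(1) unfolding d_eq by metis
  then show thesis using that[of m r \<rho>\<^sub>1 \<rho>\<^sub>2] m \<open>r < d\<close> \<sigma>(2) by simp
qed

text \<open>Strong induction on the dimension, splitting a reducible representation into two smaller
  ones. A list lets characters occur with multiplicity.\<close>

lemma character_sum_irreducible:
  assumes "matrix_representation G d \<rho>"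
  shows "\<exists>\<chi>s. set \<chi>s \<subseteq> irreducible_characters G \<and>
    (\<forall>g\<in>carrier G. mat_trace (\<rho> g) = (\<Sum>\<chi>\<leftarrow>\<chi>s. \<chi> g))"
  using assms
proof (induction d arbitrary: \<rho> rule: less_induct)
  case (less d)
  show ?case
  proof (cases "d = 0")
    case True
    \<comment> \<open>Irreducibility demands positive dimension, so dimension 0 is treated apart:
      the trace is an empty sum, matched by the empty list.\<close>
    then have "mat_trace (\<rho> g) = 0" if "g \<in> carrier G" for g
      using mat_trace_carrier[OF matrix_representation_carrier[OF less.prems that]] by simp
    then show ?thesis by (intro exI[of _ "[]"]) simp
  next
    case False
    show ?thesis
    proof (cases "irreducible_representation G d \<rho>")
      case True
      then show ?thesis
        by (intro exI[of _ "[character_of G \<rho>]"]) (auto simp: irreducible_characters_def character_of_def)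
    next
      case red: False
      from False have "d > 0" by simp
      obtain m r \<rho>\<^sub>1 \<rho>\<^sub>2 where mr: "m < d" "r < d" "matrix_representation G m \<rho>\<^sub>1" "matrix_representation G r \<rho>\<^sub>2"
        and tr: "\<And>g. g \<in> carrier G \<Longrightarrow> mat_trace (\<rho> g) = mat_trace (\<rho>\<^sub>1 g) + mat_trace (\<rho>\<^sub>2 g)"
        using reducible_representation[OF less.prems \<open>d > 0\<close> red] by metis
      obtain \<chi>s where "set \<chi>s \<subseteq> irreducible_characters G" "\<forall>g\<in>carrier G. mat_trace (\<rho>\<^sub>1 g) = (\<Sum>\<chi>\<leftarrow>\<chi>s. \<chi> g)"
        using less.IH[OF mr(1,3)] by blast
      moreover obtain \<psi>s where "set \<psi>s \<subseteq> irreducible_characters G" "\<forall>g\<in>carrier G. mat_trace (\<rho>\<^sub>2 g) = (\<Sum>\<chi>\<leftarrow>\<psi>s. \<chi> g)"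
        using less.IH[OF mr(2,4)] by blast
      ultimately show ?thesis using tr by (intro exI[of _ "\<chi>s @ \<psi>s"]) auto
    qed
  qed
qed

end

section \<open>Orthogonality of irreducible characters\<close>

lemma (in group) bij_betw_lmult: "h \<in> carrier G \<Longrightarrow> bij_betw (\<lambda>g. h \<otimes> g) (carrier G) (carrier G)"
  by (rule bij_betw_byWitness[of _ "\<lambda>g. inv h \<otimes> g"]) (auto simp: m_assoc[symmetric])

text \<open>The matrix units E_ij.\<close>

definition elementary_mat :: "nat \<Rightarrow> nat \<Rightarrow> nat \<Rightarrow> nat \<Rightarrow> 'a::comm_ring_1 mat" where
  "elementary_mat n m i j = mat n m (\<lambda>(a, b). if a = i \<and> b = j then 1 else 0)"

lemma elementary_mat_carrier [simp]: "elementary_mat n m i j \<in> carrier_mat n m"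
  by (simp add: elementary_mat_def)

text \<open>A matrix unit in the middle turns a product of two diagonal entries, as it arises from a
  product of traces, into one entry of a matrix product, to which averaging applies.\<close>

lemma index_mult_elementary_mat:
  fixes A B :: "'a::comm_ring_1 mat"
  assumes A: "A \<in> carrier_mat n n" and B: "B \<in> carrier_mat m m" and ij: "i < n" "j < m"
  shows "(A * elementary_mat n m i j * B) $$ (i, j) = A $$ (i, i) * B $$ (j, j)"
proof -
  let ?E = "elementary_mat n m i j"
  have AE: "(A * ?E) $$ (i, k) = (if k = j then A $$ (i, i) else 0)" if "k < m" for k
  proof -
    have "(A * ?E) $$ (i, k) = (\<Sum>l<n. A $$ (i, l) * ?E $$ (l, k))"
      using index_mult_mat_sum[OF A elementary_mat_carrier ij(1) that] .
    also have "\<dots> = (\<Sum>l<n. if l = i then (if k = j then A $$ (i, i) else 0) else 0)"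
      using that ij by (intro sum.cong) (auto simp: elementary_mat_def)
    finally show ?thesis using ij by simp
  qed
  have "(A * ?E * B) $$ (i, j) = (\<Sum>k<m. (A * ?E) $$ (i, k) * B $$ (k, j))"
    using A B ij by (intro index_mult_mat_sum[of _ n m _ m]) auto
  also have "\<dots> = (\<Sum>k<m. if k = j then A $$ (i, i) * B $$ (j, j) else 0)"
    using AE by (intro sum.cong) auto
  finally show ?thesis using ij by simp
qed

section \<open>Averaged intertwiners\<close>

locale finite_group = group +
  assumes finite_carrier: "finite (carrier G)"
begin

lemma order_nonzero [simp]: "Coset.order G \<noteq> 0"
  using finite_carrier order_gt_0_iff_finite by simp

text \<open>The average is left without the factor 1/|G|, and \<open>inv g\<close> instead of an
  adjoint makes it suit representations that are not unitary.\<close>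

definition averaged_intertwiner ::
    "nat \<Rightarrow> nat \<Rightarrow> ('a \<Rightarrow> complex mat) \<Rightarrow> ('a \<Rightarrow> complex mat) \<Rightarrow> complex mat \<Rightarrow> complex mat" where
  "averaged_intertwiner e d \<sigma> \<rho> A = matrix_sum e d (\<lambda>g. \<sigma> g * A * \<rho> (inv g)) (carrier G)"

text \<open>Substituting \<open>h \<otimes> g\<close> for \<open>g\<close> permutes the summands; it
  brings out \<open>\<sigma> h\<close> on the left, while
  \<open>inv (h \<otimes> g) \<otimes> h = inv g\<close> absorbs \<open>\<rho> h\<close> on the
  right.\<close>

lemma averaged_intertwiner_commute:
  assumes \<rho>: "matrix_representation G d \<rho>" and \<sigma>: "matrix_representation G e \<sigma>"
    and A: "A \<in> carrier_mat e d" and h: "h \<in> carrier G"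
  shows "\<sigma> h * averaged_intertwiner e d \<sigma> \<rho> A = averaged_intertwiner e d \<sigma> \<rho> A * \<rho> h"
proof -
  note c = matrix_representation_carrier[OF \<rho>] matrix_representation_carrier[OF \<sigma>]
  have car: "\<sigma> g * A * \<rho> (inv g) \<in> carrier_mat e d" if "g \<in> carrier G" for g
    using c that A by (intro mult_carrier_mat[of _ e d] mult_carrier_mat[of _ e e]) auto
  have "averaged_intertwiner e d \<sigma> \<rho> A * \<rho> h
      = matrix_sum e d (\<lambda>g. \<sigma> g * A * \<rho> (inv g) * \<rho> h) (carrier G)"
    unfolding averaged_intertwiner_def using c h car by (intro matrix_sum_mult) auto
  also have "carrier G = (\<lambda>g. h \<otimes> g) ` carrier G"
    using bij_betw_lmult[OF h] by (simp add: bij_betw_def)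
  also have "matrix_sum e d (\<lambda>g. \<sigma> g * A * \<rho> (inv g) * \<rho> h) ((\<lambda>g. h \<otimes> g) ` carrier G)
      = matrix_sum e d (\<lambda>g. \<sigma> (h \<otimes> g) * A * \<rho> (inv (h \<otimes> g)) * \<rho> h) (carrier G)"
    using bij_betw_lmult[OF h] by (intro matrix_sum_reindex) (simp add: bij_betw_def)
  also have "\<dots> = matrix_sum e d (\<lambda>g. \<sigma> h * (\<sigma> g * A * \<rho> (inv g))) (carrier G)"
  proof (rule matrix_sum_cong)
    fix g assume g: "g \<in> carrier G"
    have "\<rho> (inv (h \<otimes> g)) * \<rho> h = \<rho> (inv (h \<otimes> g) \<otimes> h)"
      using g h by (simp add: matrix_representation_mult[OF \<rho>])
    also have "inv (h \<otimes> g) \<otimes> h = inv g"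
      using g h by (simp add: inv_mult_group m_assoc)
    finally have *: "\<rho> (inv (h \<otimes> g)) * \<rho> h = \<rho> (inv g)" .
    have C: "\<sigma> h \<in> carrier_mat e e" "\<sigma> g \<in> carrier_mat e e" "\<rho> (inv g) \<in> carrier_mat d d"
      "\<sigma> (h \<otimes> g) \<in> carrier_mat e e" "\<rho> (inv (h \<otimes> g)) \<in> carrier_mat d d" "\<rho> h \<in> carrier_mat d d"
      using g h by (auto intro: c)
    have "\<sigma> (h \<otimes> g) * A * \<rho> (inv (h \<otimes> g)) * \<rho> h = \<sigma> (h \<otimes> g) * A * \<rho> (inv g)"
      using assoc_mult_mat[OF mult_carrier_mat[OF C(4) A] C(5,6)] * by simp
    also have "\<dots> = \<sigma> h * (\<sigma> g * A) * \<rho> (inv g)"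
      using assoc_mult_mat[OF C(1,2) A] g h by (simp add: matrix_representation_mult[OF \<sigma>])
    also have "\<sigma> h * (\<sigma> g * A) * \<rho> (inv g) = \<sigma> h * (\<sigma> g * A * \<rho> (inv g))"
      by (rule assoc_mult_mat[OF C(1) mult_carrier_mat[OF C(2) A] C(3)])
    finally show "\<sigma> (h \<otimes> g) * A * \<rho> (inv (h \<otimes> g)) * \<rho> h = \<sigma> h * (\<sigma> g * A * \<rho> (inv g))" .
  qed
  also have "\<dots> = \<sigma> h * averaged_intertwiner e d \<sigma> \<rho> A"
    unfolding averaged_intertwiner_def using c h car by (intro mult_matrix_sum[symmetric]) auto
  finally show ?thesis ..
qed

text \<open>The product of traces expands into products of diagonal entries, each of which is an
  entry of a matrix unit multiplied by \<open>\<sigma> g\<close> and \<open>\<rho> (inv g)\<close>.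
  Exchanging the sums makes Schur's lemma available for each average.\<close>

lemma sum_trace_mult_trace:
  assumes \<rho>: "matrix_representation G d \<rho>" and \<sigma>: "matrix_representation G e \<sigma>"
  shows "(\<Sum>g\<in>carrier G. mat_trace (\<sigma> g) * mat_trace (\<rho> (inv g)))
    = (\<Sum>i<e. \<Sum>j<d. averaged_intertwiner e d \<sigma> \<rho> (elementary_mat e d i j) $$ (i, j))"
proof -
  note c = matrix_representation_carrier[OF \<rho>] matrix_representation_carrier[OF \<sigma>]
  have "(\<Sum>g\<in>carrier G. mat_trace (\<sigma> g) * mat_trace (\<rho> (inv g)))
      = (\<Sum>g\<in>carrier G. \<Sum>i<e. \<Sum>j<d. \<sigma> g $$ (i, i) * \<rho> (inv g) $$ (j, j))"
  proof (intro sum.cong refl)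
    fix g assume g: "g \<in> carrier G"
    show "mat_trace (\<sigma> g) * mat_trace (\<rho> (inv g)) = (\<Sum>i<e. \<Sum>j<d. \<sigma> g $$ (i, i) * \<rho> (inv g) $$ (j, j))"
      using mat_trace_carrier[OF c(2)[OF g]] mat_trace_carrier[OF c(1)[of "inv g"]] g
      by (simp add: sum_product)
  qed
  also have "\<dots> = (\<Sum>i<e. \<Sum>g\<in>carrier G. \<Sum>j<d. \<sigma> g $$ (i, i) * \<rho> (inv g) $$ (j, j))"
    by (rule sum.swap)
  also have "\<dots> = (\<Sum>i<e. \<Sum>j<d. \<Sum>g\<in>carrier G. \<sigma> g $$ (i, i) * \<rho> (inv g) $$ (j, j))"
    by (intro sum.cong refl sum.swap)
  also have "\<dots> = (\<Sum>i<e. \<Sum>j<d. averaged_intertwiner e d \<sigma> \<rho> (elementary_mat e d i j) $$ (i, j))"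
  proof (intro sum.cong refl)
    fix i j assume ij: "i \<in> {..<e}" "j \<in> {..<d}"
    have "\<sigma> g $$ (i, i) * \<rho> (inv g) $$ (j, j) = (\<sigma> g * elementary_mat e d i j * \<rho> (inv g)) $$ (i, j)"
      if "g \<in> carrier G" for g
      using index_mult_elementary_mat[OF c(2)[OF that] c(1)[of "inv g"]] that ij by simp
    then show "(\<Sum>g\<in>carrier G. \<sigma> g $$ (i, i) * \<rho> (inv g) $$ (j, j))
        = averaged_intertwiner e d \<sigma> \<rho> (elementary_mat e d i j) $$ (i, j)"
      using ij by (simp add: averaged_intertwiner_def)
  qed
  finally show ?thesis .
qed

text \<open>Schur's lemma makes the average a scalar, and its trace is |G| times that of
  \<open>A\<close>, since every summand is a conjugate of \<open>A\<close>.\<close>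

lemma averaged_intertwiner_scalar:
  assumes irr: "irreducible_representation G d \<rho>" and A: "A \<in> carrier_mat d d"
  shows "averaged_intertwiner d d \<rho> \<rho> A = (of_nat (Coset.order G) * mat_trace A / of_nat d) \<cdot>\<^sub>m 1\<^sub>m d"
proof -
  let ?T = "averaged_intertwiner d d \<rho> \<rho> A"
  have \<rho>: "matrix_representation G d \<rho>" by (rule irreducible_imp_representation[OF irr])
  note c = matrix_representation_carrier[OF \<rho>]
  have "mat_trace ?T = (\<Sum>g\<in>carrier G. mat_trace (\<rho> g * A * \<rho> (inv g)))"
    unfolding averaged_intertwiner_def
    using c A by (intro mat_trace_matrix_sum mult_carrier_mat[of _ d d]) auto
  also have "\<dots> = (\<Sum>g\<in>carrier G. mat_trace A)"
  proof (intro sum.cong refl)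
    fix g assume g: "g \<in> carrier G"
    have C: "\<rho> g \<in> carrier_mat d d" "\<rho> (inv g) \<in> carrier_mat d d" using g by (auto intro: c)
    have "mat_trace (\<rho> g * A * \<rho> (inv g)) = mat_trace (\<rho> (inv g) * (\<rho> g * A))"
      by (rule mat_trace_mult_commute[OF mult_carrier_mat[OF C(1) A] C(2)])
    also have "\<rho> (inv g) * (\<rho> g * A) = \<rho> (inv g \<otimes> g) * A"
      using assoc_mult_mat[OF C(2,1) A] matrix_representation_mult[OF \<rho>, of "inv g" g] g by simp
    also have "\<dots> = A" using A g by (simp add: matrix_representation_one[OF \<rho>])
    finally show "mat_trace (\<rho> g * A * \<rho> (inv g)) = mat_trace A" .
  qed
  also have "\<dots> = of_nat (Coset.order G) * mat_trace A" by (simp add: Coset.order_def)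
  finally have "mat_trace ?T = of_nat (Coset.order G) * mat_trace A" .
  moreover have "?T = (mat_trace ?T / of_nat d) \<cdot>\<^sub>m 1\<^sub>m d"
  proof (rule schur_scalar[OF irr])
    show "?T \<in> carrier_mat d d" by (simp add: averaged_intertwiner_def)
  qed (rule averaged_intertwiner_commute[OF \<rho> \<rho> A])
  ultimately show ?thesis by simp
qed

lemma character_orthogonality:
  assumes \<chi>: "\<chi> \<in> irreducible_characters G" and \<psi>: "\<psi> \<in> irreducible_characters G"
  shows "(\<Sum>g\<in>carrier G. \<chi> g * \<psi> (inv g)) = (if \<chi> = \<psi> then of_nat (Coset.order G) else 0)"
proof (cases "\<chi> = \<psi>")
  case True
  obtain d \<rho> where irr: "irreducible_representation G d \<rho>" and \<chi>_eq: "\<chi> = character_of G \<rho>"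
    using \<chi> by (auto simp: irreducible_characters_def)
  have \<rho>: "matrix_representation G d \<rho>" by (rule irreducible_imp_representation[OF irr])
  have "(\<Sum>g\<in>carrier G. \<chi> g * \<psi> (inv g)) = (\<Sum>g\<in>carrier G. mat_trace (\<rho> g) * mat_trace (\<rho> (inv g)))"
    by (simp add: True[symmetric] \<chi>_eq character_of_def)
  \<comment> \<open>The matrix unit has trace 1 on the diagonal and 0 off it, so only
    \<open>d\<close> terms survive, each worth |G|/d.\<close>
  also have "\<dots> = (\<Sum>i<d. \<Sum>j<d. if i = j then of_nat (Coset.order G) / of_nat d else 0)"
    unfolding sum_trace_mult_trace[OF \<rho> \<rho>]
  proof (intro sum.cong refl)
    fix i j assume ij: "i \<in> {..<d}" "j \<in> {..<d}"
    have "mat_trace (elementary_mat d d i j) = (\<Sum>k<d. if k = i then (if i = j then 1 else 0) else 0 :: complex)"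
      unfolding mat_trace_carrier[OF elementary_mat_carrier]
      using ij by (intro sum.cong) (auto simp: elementary_mat_def)
    then have "mat_trace (elementary_mat d d i j) = (if i = j then 1 else 0 :: complex)" using ij by simp
    then show "averaged_intertwiner d d \<rho> \<rho> (elementary_mat d d i j) $$ (i, j)
        = (if i = j then of_nat (Coset.order G) / of_nat d else 0)"
      using ij by (simp add: averaged_intertwiner_scalar[OF irr])
  qed
  also have "\<dots> = of_nat (Coset.order G)"
    using irreducible_dim_pos[OF irr] by simp
  finally show ?thesis using True by simp
next
  case False
  obtain d \<rho> where irr\<rho>: "irreducible_representation G d \<rho>" and \<psi>_eq: "\<psi> = character_of G \<rho>"
    using \<psi> by (auto simp: irreducible_characters_def)
  obtain e \<sigma> where irr\<sigma>: "irreducible_representation G e \<sigma>" and \<chi>_eq: "\<chi> = character_of G \<sigma>"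
    using \<chi> by (auto simp: irreducible_characters_def)
  note \<rho> = irreducible_imp_representation[OF irr\<rho>]
  note \<sigma> = irreducible_imp_representation[OF irr\<sigma>]
  \<comment> \<open>A nonzero average would intertwine the two irreducible representations and force
    equal traces. Then \<open>\<chi> = \<psi>\<close> even as functions, because both are
    \<open>undefined\<close> outside the carrier.\<close>
  have zero: "averaged_intertwiner e d \<sigma> \<rho> A = 0\<^sub>m e d" if A: "A \<in> carrier_mat e d" for A
  proof (rule ccontr)
    assume nz: "averaged_intertwiner e d \<sigma> \<rho> A \<noteq> 0\<^sub>m e d"
    have car: "averaged_intertwiner e d \<sigma> \<rho> A \<in> carrier_mat e d" by (simp add: averaged_intertwiner_def)
    have "mat_trace (\<sigma> g) = mat_trace (\<rho> g)" if "g \<in> carrier G" for g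
      by (rule irreducible_intertwiner_trace[OF irr\<rho> irr\<sigma> car nz averaged_intertwiner_commute[OF \<rho> \<sigma> A] that])
    then have "\<chi> = \<psi>" by (auto simp: \<chi>_eq \<psi>_eq character_of_def)
    with False show False ..
  qed
  have "(\<Sum>g\<in>carrier G. \<chi> g * \<psi> (inv g)) = (\<Sum>g\<in>carrier G. mat_trace (\<sigma> g) * mat_trace (\<rho> (inv g)))"
    by (simp add: \<chi>_eq \<psi>_eq character_of_def)
  also have "\<dots> = 0" unfolding sum_trace_mult_trace[OF \<rho> \<sigma>] by (simp add: zero)
  finally show ?thesis using False by simp
qed

end

section \<open>The regular character and central characters\<close>

lemma sum_list_map_eq_sum_of_nat_count:
  "(\<Sum>x\<leftarrow>xs. f x) = (\<Sum>x\<in>set xs. of_nat (count_list xs x) * (f x :: 'b::semiring_1))"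
proof (induction xs)
  case (Cons y xs)
  have "(\<Sum>x\<in>set (y # xs). of_nat (count_list (y # xs) x) * f x)
      = (\<Sum>x\<in>insert y (set xs). of_nat (count_list xs x) * f x + (if x = y then f x else 0))"
    by (intro sum.cong) (auto simp: algebra_simps)
  also have "\<dots> = (\<Sum>x\<in>insert y (set xs). of_nat (count_list xs x) * f x) + f y"
    by (simp add: sum.distrib)
  also have "(\<Sum>x\<in>insert y (set xs). of_nat (count_list xs x) * f x)
      = (\<Sum>x\<in>set xs. of_nat (count_list xs x) * f x)"
    by (rule sum.mono_neutral_right) auto
  finally show ?case using Cons.IH by (simp add: add.commute)
qed simp

section \<open>Regular representation, multiplicities and central characters\<close>

context finite_group
begin

text \<open>Left translations are written as permutation matrices with respect to an enumeration
  \<open>xs\<close> of the group. The trace counts fixed points, and only translation by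
  \<open>\<one>\<close> has any.\<close>

lemma regular_representation:
  obtains \<rho> where "matrix_representation G (Coset.order G) \<rho>"
    "\<And>g. g \<in> carrier G \<Longrightarrow> mat_trace (\<rho> g) = (if g = \<one> then of_nat (Coset.order G) else 0)"
proof -
  obtain xs where xs: "set xs = carrier G" "distinct xs"
    using finite_distinct_list[OF finite_carrier] by blast
  define N where "N = Coset.order G"
  have N: "length xs = N" using distinct_card[OF xs(2)] xs(1) by (simp add: N_def Coset.order_def)
  have nth: "xs ! i \<in> carrier G" if "i < N" for i using that N xs(1) nth_mem by metis
  define \<rho> where "\<rho> g = mat N N (\<lambda>(i, j). if xs ! i = g \<otimes> xs ! j then 1 else 0 :: complex)" for g
  have c: "\<rho> g \<in> carrier_mat N N" for g by (simp add: \<rho>_def)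
  have "matrix_representation G N \<rho>"
  proof (rule matrix_representationI)
    fix g h assume g: "g \<in> carrier G" and h: "h \<in> carrier G"
    show "\<rho> (g \<otimes> h) = \<rho> g * \<rho> h"
    proof (rule eq_matI)
      fix i j assume "i < dim_row (\<rho> g * \<rho> h)" "j < dim_col (\<rho> g * \<rho> h)"
      then have ij: "i < N" "j < N" by (auto simp: \<rho>_def)
      have "h \<otimes> xs ! j \<in> set xs" using h nth[OF ij(2)] xs by simp
      \<comment> \<open>Column \<open>j\<close> of \<open>\<rho> h\<close> has its only nonzero
        entry in row \<open>l\<close>, which collapses the inner sum.\<close>
      then obtain l where l: "l < N" "xs ! l = h \<otimes> xs ! j" using N by (auto simp: in_set_conv_nth)
      have "(\<rho> g * \<rho> h) $$ (i, j) = (\<Sum>k<N. \<rho> g $$ (i, k) * \<rho> h $$ (k, j))"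
        by (rule index_mult_mat_sum[OF c c ij])
      also have "\<dots> = (\<Sum>k<N. if k = l then \<rho> g $$ (i, l) else 0)"
      proof (intro sum.cong refl)
        fix k assume "k \<in> {..<N}"
        then show "\<rho> g $$ (i, k) * \<rho> h $$ (k, j) = (if k = l then \<rho> g $$ (i, l) else 0)"
          using l ij N nth_eq_iff_index_eq[OF xs(2), of k l] by (simp add: \<rho>_def)
      qed
      also have "\<dots> = \<rho> g $$ (i, l)" using l by simp
      also have "\<dots> = \<rho> (g \<otimes> h) $$ (i, j)"
        using l ij g h nth[OF ij(2)] by (simp add: \<rho>_def m_assoc)
      finally show "\<rho> (g \<otimes> h) $$ (i, j) = (\<rho> g * \<rho> h) $$ (i, j)" ..
    qed (auto simp: \<rho>_def)
  next
    show "\<rho> \<one> = 1\<^sub>m N"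
      using nth N nth_eq_iff_index_eq[OF xs(2)] by (intro eq_matI) (auto simp: \<rho>_def)
  qed (rule c)
  moreover have "mat_trace (\<rho> g) = (if g = \<one> then of_nat N else 0)" if g: "g \<in> carrier G" for g
  proof -
    have "mat_trace (\<rho> g) = (\<Sum>i<N. if g = \<one> then 1 else 0)"
      unfolding mat_trace_carrier[OF c]
    proof (intro sum.cong refl)
      fix i assume "i \<in> {..<N}"
      then show "\<rho> g $$ (i, i) = (if g = \<one> then 1 else 0)"
        using nth[of i] g l_cancel_one[of "xs ! i" g] by (auto simp: \<rho>_def r_cancel_one')
    qed
    then show ?thesis by simp
  qed
  ultimately show thesis using that unfolding N_def by blast
qed

lemma irreducible_character_one_nonzero:
  "\<chi> \<in> irreducible_characters G \<Longrightarrow> \<chi> \<one> \<noteq> 0"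
  by (auto simp: irreducible_characters_def character_of_def mat_trace_one
      matrix_representation_one[OF irreducible_imp_representation] dest: irreducible_dim_pos)

text \<open>The regular character is decomposed into irreducible characters and paired with
  \<open>\<chi> (inv g)\<close>. Direct evaluation gives |G| times \<open>\<chi> \<one>\<close>,
  orthogonality gives |G| times the multiplicity of \<open>\<chi>\<close>, so multiplicities are
  degrees.\<close>

lemma irreducible_characters_regular:
  shows finite_irreducible_characters: "finite (irreducible_characters G)"
    and sum_irreducible_characters: "\<And>g. g \<in> carrier G \<Longrightarrow>
      (\<Sum>\<chi>\<in>irreducible_characters G. \<chi> \<one> * \<chi> g) = (if g = \<one> then of_nat (Coset.order G) else 0)"
proof -
  let ?N = "of_nat (Coset.order G) :: complex"
  obtain \<rho> where \<rho>: "matrix_representation G (Coset.order G) \<rho>"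
    and tr: "\<And>g. g \<in> carrier G \<Longrightarrow> mat_trace (\<rho> g) = (if g = \<one> then ?N else 0)"
    using regular_representation by metis
  obtain \<chi>s where sub: "set \<chi>s \<subseteq> irreducible_characters G"
    and dec: "\<And>g. g \<in> carrier G \<Longrightarrow> mat_trace (\<rho> g) = (\<Sum>\<chi>\<leftarrow>\<chi>s. \<chi> g)"
    using character_sum_irreducible[OF \<rho>] by blast
  have reg: "(\<Sum>\<psi>\<in>set \<chi>s. of_nat (count_list \<chi>s \<psi>) * \<psi> g) = (if g = \<one> then ?N else 0)"
    if "g \<in> carrier G" for g
    using dec[OF that] tr[OF that] by (simp add: sum_list_map_eq_sum_of_nat_count)
  have count: "of_nat (count_list \<chi>s \<chi>) = \<chi> \<one>" if \<chi>: "\<chi> \<in> irreducible_characters G" for \<chi>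
  proof -
    have "?N * \<chi> \<one> = (\<Sum>g\<in>carrier G. if g = \<one> then ?N * \<chi> (inv g) else 0)"
      using finite_carrier by simp
    also have "\<dots> = (\<Sum>g\<in>carrier G. \<Sum>\<psi>\<in>set \<chi>s. of_nat (count_list \<chi>s \<psi>) * \<psi> g * \<chi> (inv g))"
      using reg by (intro sum.cong) (auto simp: sum_distrib_right[symmetric])
    also have "\<dots> = (\<Sum>\<psi>\<in>set \<chi>s. of_nat (count_list \<chi>s \<psi>) * (\<Sum>g\<in>carrier G. \<psi> g * \<chi> (inv g)))"
      by (subst sum.swap) (simp add: sum_distrib_left mult.assoc)
    also have "\<dots> = (\<Sum>\<psi>\<in>set \<chi>s. if \<psi> = \<chi> then of_nat (count_list \<chi>s \<chi>) * ?N else 0)"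
      using sub character_orthogonality[OF _ \<chi>] by (intro sum.cong) auto
    also have "\<dots> = of_nat (count_list \<chi>s \<chi>) * ?N"
      by (auto simp: count_list_0_iff)
    finally show ?thesis by simp
  qed
  \<comment> \<open>Degrees are nonzero, so every irreducible character occurs in the list
    \<open>\<chi>s\<close>; finiteness follows from this.\<close>
  have "irreducible_characters G \<subseteq> set \<chi>s"
    using irreducible_character_one_nonzero count by (metis count_list_0_iff of_nat_0 subsetI)
  with sub have eq: "set \<chi>s = irreducible_characters G" by blast
  then show "finite (irreducible_characters G)" by (metis List.finite_set)
  show "(\<Sum>\<chi>\<in>irreducible_characters G. \<chi> \<one> * \<chi> g) = (if g = \<one> then ?N else 0)"
    if "g \<in> carrier G" for g
    using reg[OF that] count by (simp add: eq)
qed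

text \<open>Schur's lemma for the sum of \<open>\<rho> (f a)\<close> over a set stable under
  conjugation; the factor on the right is the scalar by which this sum acts. It is applied with
  \<open>f\<close> the identity on a conjugacy class and with squaring on the whole group.\<close>

lemma central_character:
  assumes \<chi>: "\<chi> \<in> irreducible_characters G" and S: "S \<subseteq> carrier G"
    and f: "\<And>a. a \<in> S \<Longrightarrow> f a \<in> carrier G"
    and conj: "\<And>h a. h \<in> carrier G \<Longrightarrow> a \<in> S \<Longrightarrow> h \<otimes> a \<otimes> inv h \<in> S"
    and f_conj: "\<And>h a. h \<in> carrier G \<Longrightarrow> a \<in> S \<Longrightarrow> f (h \<otimes> a \<otimes> inv h) = h \<otimes> f a \<otimes> inv h"
    and x: "x \<in> carrier G"
  shows "(\<Sum>a\<in>S. \<chi> (x \<otimes> f a)) = (\<Sum>a\<in>S. \<chi> (f a)) / \<chi> \<one> * \<chi> x"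
proof -
  obtain d \<rho> where irr: "irreducible_representation G d \<rho>" and \<chi>_eq: "\<chi> = character_of G \<rho>"
    using \<chi> by (auto simp: irreducible_characters_def)
  have \<rho>: "matrix_representation G d \<rho>" by (rule irreducible_imp_representation[OF irr])
  note c = matrix_representation_carrier[OF \<rho>]
  define T where "T = matrix_sum d d (\<lambda>a. \<rho> (f a)) S"
  have T: "T \<in> carrier_mat d d" by (simp add: T_def)
  have mult: "\<rho> h * T = matrix_sum d d (\<lambda>a. \<rho> (h \<otimes> f a)) S" if h: "h \<in> carrier G" for h
  proof -
    have "\<rho> h * T = matrix_sum d d (\<lambda>a. \<rho> h * \<rho> (f a)) S"
      unfolding T_def using c h f by (intro mult_matrix_sum) auto
    also have "\<dots> = matrix_sum d d (\<lambda>a. \<rho> (h \<otimes> f a)) S"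
      using matrix_representation_mult[OF \<rho>] h f by (intro matrix_sum_cong) simp
    finally show ?thesis .
  qed
  \<comment> \<open>Conjugation by \<open>h\<close> permutes \<open>S\<close> and is respected by
    \<open>f\<close>, so moving \<open>\<rho> h\<close> past the sum merely reorders its
    terms.\<close>
  have "T = (mat_trace T / of_nat d) \<cdot>\<^sub>m 1\<^sub>m d"
  proof (rule schur_scalar[OF irr T])
    fix h assume h: "h \<in> carrier G"
    let ?c = "\<lambda>a. h \<otimes> a \<otimes> inv h"
    have bij: "bij_betw ?c S S"
    proof (rule bij_betw_byWitness[of _ "\<lambda>a. inv h \<otimes> a \<otimes> h"])
      show "\<forall>a\<in>S. inv h \<otimes> (h \<otimes> a \<otimes> inv h) \<otimes> h = a" "\<forall>a\<in>S. h \<otimes> (inv h \<otimes> a \<otimes> h) \<otimes> inv h = a"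
        using S h by (auto simp: m_assoc subset_iff) (simp_all add: m_assoc[symmetric])
      show "?c ` S \<subseteq> S" using conj h by auto
      show "(\<lambda>a. inv h \<otimes> a \<otimes> h) ` S \<subseteq> S" using conj[of "inv h"] h by auto
    qed
    have "T * \<rho> h = matrix_sum d d (\<lambda>a. \<rho> (f a) * \<rho> h) S"
      unfolding T_def using c h f by (intro matrix_sum_mult) auto
    also have "\<dots> = matrix_sum d d (\<lambda>a. \<rho> (f a) * \<rho> h) (?c ` S)"
      using bij by (simp add: bij_betw_def)
    also have "\<dots> = matrix_sum d d (\<lambda>a. \<rho> (f (?c a)) * \<rho> h) S"
      using bij by (intro matrix_sum_reindex) (simp add: bij_betw_def)
    also have "\<dots> = matrix_sum d d (\<lambda>a. \<rho> (h \<otimes> f a)) S"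
    proof (rule matrix_sum_cong)
      fix a assume a: "a \<in> S"
      have "\<rho> (f (?c a)) * \<rho> h = \<rho> (f (?c a) \<otimes> h)"
        using matrix_representation_mult[OF \<rho>] f[OF conj[OF h a]] h by simp
      also have "f (?c a) \<otimes> h = h \<otimes> f a"
        using f_conj[OF h a] f[OF a] h by (simp add: m_assoc)
      finally show "\<rho> (f (?c a)) * \<rho> h = \<rho> (h \<otimes> f a)" .
    qed
    finally show "\<rho> h * T = T * \<rho> h" using mult[OF h] by simp
  qed
  moreover have "mat_trace T = (\<Sum>a\<in>S. \<chi> (f a))"
    unfolding T_def using c f by (subst mat_trace_matrix_sum) (auto simp: \<chi>_eq character_of_def)
  moreover have "\<chi> \<one> = of_nat d"
    by (simp add: \<chi>_eq character_of_def matrix_representation_one[OF \<rho>] mat_trace_one)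
  ultimately have T_eq: "T = ((\<Sum>a\<in>S. \<chi> (f a)) / \<chi> \<one>) \<cdot>\<^sub>m 1\<^sub>m d" by simp
  have "(\<Sum>a\<in>S. \<chi> (x \<otimes> f a)) = (\<Sum>a\<in>S. mat_trace (\<rho> (x \<otimes> f a)))"
    using f x by (intro sum.cong) (auto simp: \<chi>_eq character_of_def)
  also have "\<dots> = mat_trace (\<rho> x * T)"
    unfolding mult[OF x] using c f x by (intro mat_trace_matrix_sum[symmetric]) auto
  also have "\<rho> x * T = ((\<Sum>a\<in>S. \<chi> (f a)) / \<chi> \<one>) \<cdot>\<^sub>m \<rho> x"
    unfolding T_eq using c[OF x] mult_smult_distrib[OF c[OF x] one_carrier_mat] by simp
  also have "mat_trace \<dots> = (\<Sum>a\<in>S. \<chi> (f a)) / \<chi> \<one> * \<chi> x"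
    using x mat_trace_smult[OF c[OF x]] by (simp add: \<chi>_eq character_of_def)
  finally show ?thesis .
qed

lemma irreducible_character_conj:
  assumes \<chi>: "\<chi> \<in> irreducible_characters G" and g: "g \<in> carrier G" and h: "h \<in> carrier G"
  shows "\<chi> (h \<otimes> g \<otimes> inv h) = \<chi> g"
proof -
  obtain d \<rho> where irr: "irreducible_representation G d \<rho>" and \<chi>_eq: "\<chi> = character_of G \<rho>"
    using \<chi> by (auto simp: irreducible_characters_def)
  have \<rho>: "matrix_representation G d \<rho>" by (rule irreducible_imp_representation[OF irr])
  note c = matrix_representation_carrier[OF \<rho>]
  have "mat_trace (\<rho> (h \<otimes> g \<otimes> inv h)) = mat_trace (\<rho> (h \<otimes> g) * \<rho> (inv h))"
    using matrix_representation_mult[OF \<rho>] g h by simp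
  also have "\<dots> = mat_trace (\<rho> (inv h) * \<rho> (h \<otimes> g))"
    using c g h by (intro mat_trace_mult_commute[of _ d d]) auto
  also have "\<dots> = mat_trace (\<rho> (inv h \<otimes> (h \<otimes> g)))"
    using matrix_representation_mult[OF \<rho>, of "inv h" "h \<otimes> g"] g h by simp
  also have "inv h \<otimes> (h \<otimes> g) = g" using g h by (simp add: m_assoc[symmetric])
  finally show ?thesis using g h by (simp add: \<chi>_eq character_of_def)
qed

lemma conjugacy_class_props:
  assumes C: "C \<in> conjugacy_classes G"
  shows conjugacy_class_subset: "C \<subseteq> carrier G"
    and conjugacy_class_conj: "\<And>h a. h \<in> carrier G \<Longrightarrow> a \<in> C \<Longrightarrow> h \<otimes> a \<otimes> inv h \<in> C"
    and sum_conjugacy_class: "\<And>\<chi>. \<chi> \<in> irreducible_characters G \<Longrightarrow>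
      (\<Sum>a\<in>C. \<chi> a) = of_nat (card C) * class_value \<chi> C"
proof -
  obtain x where x: "x \<in> carrier G" and C_eq: "C = {g \<otimes> x \<otimes> inv g | g. g \<in> carrier G}"
    using C by (auto simp: conjugacy_classes_def orbits_def orbit_def)
  show "C \<subseteq> carrier G" using x by (auto simp: C_eq)
  show "h \<otimes> a \<otimes> inv h \<in> C" if h: "h \<in> carrier G" and a: "a \<in> C" for h a
  proof -
    obtain g where g: "g \<in> carrier G" "a = g \<otimes> x \<otimes> inv g" using a by (auto simp: C_eq)
    have "h \<otimes> a \<otimes> inv h = (h \<otimes> g) \<otimes> x \<otimes> inv (h \<otimes> g)"
      using g h x by (simp add: m_assoc inv_mult_group)
    then show ?thesis using g h unfolding C_eq by blast
  qed
  show "(\<Sum>a\<in>C. \<chi> a) = of_nat (card C) * class_value \<chi> C" if \<chi>: "\<chi> \<in> irreducible_characters G" for \<chi>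
  proof -
    have const: "\<chi> a = \<chi> x" if "a \<in> C" for a
      using that irreducible_character_conj[OF \<chi> x] by (auto simp: C_eq)
    \<comment> \<open>The class contains \<open>x\<close>, hence is nonempty, and
      \<open>SOME\<close> picks a member at which \<open>\<chi>\<close> has the common
      value.\<close>
    have "x = \<one> \<otimes> x \<otimes> inv \<one>" using x by simp
    then have "x \<in> C" unfolding C_eq by blast
    then have "(SOME g. g \<in> C) \<in> C" by (rule someI)
    then show ?thesis using const by (simp add: class_value_def)
  qed
qed

end

section \<open>Sums over tuples and ordered products\<close>

lemma listset_subset:
  "xs \<in> listset As \<Longrightarrow> (\<And>A. A \<in> set As \<Longrightarrow> A \<subseteq> X) \<Longrightarrow> set xs \<subseteq> X"
proof (induction As arbitrary: xs)
  case (Cons A As)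
  then obtain y ys where y: "xs = y # ys" "y \<in> A" "ys \<in> listset As" by (auto simp: set_Cons_def)
  have "set ys \<subseteq> X" "A \<subseteq> X" using Cons.IH[OF y(3)] Cons.prems(2) by auto
  with y show ?case by auto
qed simp

lemma listset_Cons_image: "listset (A # As) = (\<lambda>(x, xs). x # xs) ` (A \<times> listset As)"
  by (auto simp: set_Cons_def)

lemma finite_listset: "(\<And>A. A \<in> set As \<Longrightarrow> finite A) \<Longrightarrow> finite (listset As)"
  by (induction As) (simp_all add: listset_Cons_image del: listset.simps(2))

lemma sum_listset_Cons:
  "(\<Sum>xs\<in>listset (A # As). F xs) = (\<Sum>x\<in>A. \<Sum>xs\<in>listset As. F (x # xs))"
proof -
  have inj: "inj_on (\<lambda>(x, xs). x # xs) (A \<times> listset As)" by (auto simp: inj_on_def)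
  show ?thesis
    unfolding listset_Cons_image sum.reindex[OF inj]
    by (simp add: sum.cartesian_product o_def case_prod_unfold)
qed

context group
begin

lemma ordered_product_closed [simp]: "set xs \<subseteq> carrier G \<Longrightarrow> ordered_product G xs \<in> carrier G"
  by (induction xs) (auto simp: ordered_product_def)

lemma ordered_product_append:
  "set xs \<subseteq> carrier G \<Longrightarrow> set ys \<subseteq> carrier G \<Longrightarrow>
    ordered_product G (xs @ ys) = ordered_product G xs \<otimes> ordered_product G ys"
proof (induction xs)
  case Nil
  then show ?case using ordered_product_closed[of ys] by (simp add: ordered_product_def)
next
  case (Cons x xs)
  then show ?case
    using ordered_product_closed[of xs] ordered_product_closed[of ys]
    by (simp add: ordered_product_def m_assoc)
qed

text \<open>Here \<open>x\<close> is the product of the factors to the left. Generalising over it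
  lets the induction move the head of each tuple into the prefix; summing out each set then
  contributes its scalar \<open>\<omega> A\<close>.\<close>

lemma sum_listset_ordered_product:
  fixes \<phi> :: "'a \<Rightarrow> 'c::comm_semiring_1"
  assumes "\<And>A. A \<in> set As \<Longrightarrow> A \<subseteq> carrier G"
    and f: "\<And>a. a \<in> carrier G \<Longrightarrow> f a \<in> carrier G"
    and "\<And>A x. A \<in> set As \<Longrightarrow> x \<in> carrier G \<Longrightarrow> (\<Sum>a\<in>A. \<phi> (x \<otimes> f a)) = \<omega> A * \<phi> x"
    and "x \<in> carrier G"
  shows "(\<Sum>xs\<in>listset As. \<phi> (x \<otimes> ordered_product G (map f xs))) = (\<Prod>A\<leftarrow>As. \<omega> A) * \<phi> x"
  using assms(1,3,4)
proof (induction As arbitrary: x)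
  case Nil
  then show ?case by (simp add: ordered_product_def)
next
  case (Cons A As)
  have "(\<Sum>xs\<in>listset (A # As). \<phi> (x \<otimes> ordered_product G (map f xs)))
      = (\<Sum>a\<in>A. \<Sum>xs\<in>listset As. \<phi> (x \<otimes> f a \<otimes> ordered_product G (map f xs)))"
    unfolding sum_listset_Cons
  proof (intro sum.cong refl arg_cong[of _ _ \<phi>])
    fix a xs assume "a \<in> A" and xs: "xs \<in> listset As"
    then have "a \<in> carrier G" "set xs \<subseteq> carrier G"
      using Cons.prems(1) listset_subset[OF xs, of "carrier G"] by auto
    then have "ordered_product G (map f xs) \<in> carrier G" using f by (intro ordered_product_closed) auto
    then show "x \<otimes> ordered_product G (map f (a # xs)) = x \<otimes> f a \<otimes> ordered_product G (map f xs)"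
      using \<open>a \<in> carrier G\<close> f Cons.prems(3) by (simp add: ordered_product_def m_assoc)
  qed
  also have "\<dots> = (\<Sum>a\<in>A. (\<Prod>A\<leftarrow>As. \<omega> A) * \<phi> (x \<otimes> f a))"
  proof (intro sum.cong refl Cons.IH)
    fix a assume "a \<in> A"
    then have "a \<in> carrier G" using Cons.prems(1) by auto
    then show "x \<otimes> f a \<in> carrier G" using f Cons.prems(3) by simp
  qed (use Cons.prems in auto)
  also have "\<dots> = (\<Prod>A\<leftarrow>As. \<omega> A) * (\<omega> A * \<phi> x)"
    using Cons.prems by (simp add: sum_distrib_left[symmetric])
  finally show ?case by (simp add: ac_simps)
qed

end

context finite_group
begin

lemma square_conj:
  assumes "h \<in> carrier G" "a \<in> carrier G"
  shows "(h \<otimes> a \<otimes> inv h) [^] (2::nat) = h \<otimes> a [^] (2::nat) \<otimes> inv h"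
proof -
  have "inv h \<otimes> (h \<otimes> (a \<otimes> inv h)) = a \<otimes> inv h"
    using assms by (simp add: m_assoc[symmetric])
  then show ?thesis using assms by (simp add: numeral_2_eq_2 m_assoc)
qed

text \<open>The classes are summed out first, with the product of the squares as prefix, and then
  the squares with prefix \<open>\<one>\<close>. What remains at the end is the value
  \<open>\<chi> \<one>\<close> at the empty product.\<close>

lemma sum_character_ordered_product:
  assumes \<chi>: "\<chi> \<in> irreducible_characters G" and Cs: "set Cs \<subseteq> conjugacy_classes G"
  shows "(\<Sum>gs\<in>listset (replicate k (carrier G)). \<Sum>cs\<in>listset Cs.
      \<chi> (ordered_product G (map (\<lambda>g. g [^] (2::nat)) gs @ cs)))
    = (of_nat (Coset.order G) * frobenius_schur_indicator G \<chi> / \<chi> \<one>) ^ k *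
      (\<Prod>C\<leftarrow>Cs. of_nat (card C) * class_value \<chi> C / \<chi> \<one>) * \<chi> \<one>"
proof -
  let ?sq = "\<lambda>g. g [^] (2::nat)"
  let ?\<omega> = "of_nat (Coset.order G) * frobenius_schur_indicator G \<chi> / \<chi> \<one>"
  have "(\<Sum>cs\<in>listset Cs. \<chi> (ordered_product G (map ?sq gs @ cs)))
      = (\<Prod>C\<leftarrow>Cs. of_nat (card C) * class_value \<chi> C / \<chi> \<one>) * \<chi> (\<one> \<otimes> ordered_product G (map ?sq gs))"
    if gs: "gs \<in> listset (replicate k (carrier G))" for gs
  proof -
    have "set gs \<subseteq> carrier G" using listset_subset[OF gs, of "carrier G"] by (auto split: if_splits)
    then have gs': "set (map ?sq gs) \<subseteq> carrier G" by auto
    have "(\<Sum>cs\<in>listset Cs. \<chi> (ordered_product G (map ?sq gs @ cs)))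
        = (\<Sum>cs\<in>listset Cs. \<chi> (ordered_product G (map ?sq gs) \<otimes> ordered_product G (map (\<lambda>c. c) cs)))"
    proof (intro sum.cong refl arg_cong[of _ _ \<chi>])
      fix cs assume cs: "cs \<in> listset Cs"
      have "set cs \<subseteq> carrier G"
        using listset_subset[OF cs, of "carrier G"] Cs conjugacy_class_subset by auto
      then show "ordered_product G (map ?sq gs @ cs)
          = ordered_product G (map ?sq gs) \<otimes> ordered_product G (map (\<lambda>c. c) cs)"
        using ordered_product_append[OF gs'] by simp
    qed
    also have "\<dots> = (\<Prod>C\<leftarrow>Cs. of_nat (card C) * class_value \<chi> C / \<chi> \<one>) * \<chi> (ordered_product G (map ?sq gs))"
    proof (rule sum_listset_ordered_product)
      fix C x assume "C \<in> set Cs" and x: "x \<in> carrier G"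
      then have C: "C \<in> conjugacy_classes G" using Cs by auto
      show "(\<Sum>a\<in>C. \<chi> (x \<otimes> a)) = of_nat (card C) * class_value \<chi> C / \<chi> \<one> * \<chi> x"
        using central_character[OF \<chi> conjugacy_class_subset[OF C] _ conjugacy_class_conj[OF C] _ x, of "\<lambda>a. a"]
          conjugacy_class_subset[OF C] sum_conjugacy_class[OF C \<chi>] by auto
    qed (use Cs conjugacy_class_subset ordered_product_closed[OF gs'] in auto)
    finally show ?thesis using ordered_product_closed[OF gs'] by simp
  qed
  then have "(\<Sum>gs\<in>listset (replicate k (carrier G)). \<Sum>cs\<in>listset Cs.
        \<chi> (ordered_product G (map ?sq gs @ cs)))
      = (\<Prod>C\<leftarrow>Cs. of_nat (card C) * class_value \<chi> C / \<chi> \<one>) *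
        (\<Sum>gs\<in>listset (replicate k (carrier G)). \<chi> (\<one> \<otimes> ordered_product G (map ?sq gs)))"
    by (simp add: sum_distrib_left)
  also have "(\<Sum>gs\<in>listset (replicate k (carrier G)). \<chi> (\<one> \<otimes> ordered_product G (map ?sq gs)))
      = (\<Prod>A\<leftarrow>replicate k (carrier G). ?\<omega>) * \<chi> \<one>"
  proof (rule sum_listset_ordered_product)
    fix A x assume "A \<in> set (replicate k (carrier G))" and x: "x \<in> carrier G"
    then have A: "A = carrier G" by (auto split: if_splits)
    have "(\<Sum>a\<in>carrier G. \<chi> (?sq a)) = of_nat (Coset.order G) * frobenius_schur_indicator G \<chi>"
      by (simp add: frobenius_schur_indicator_def)
    then show "(\<Sum>a\<in>A. \<chi> (x \<otimes> ?sq a)) = ?\<omega> * \<chi> x"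
      unfolding A using central_character[OF \<chi> subset_refl _ _ square_conj x] by simp
  qed (auto split: if_splits)
  finally show ?thesis by (simp add: map_replicate_const mult_ac)
qed

end

section \<open>The number of solutions as a character sum\<close>

theorem theorem3:
  fixes G :: "('a, 'b) monoid_scheme" and k n :: nat and Cs :: "'a set list"
  assumes "group G" and "finite (carrier G)"
    and "k \<ge> 1"
    and "length Cs = n" and "set Cs \<subseteq> conjugacy_classes G"
  shows "of_nat (card {(gs, cs).
             gs \<in> listset (replicate k (carrier G)) \<and> cs \<in> listset Cs \<and>
             ordered_product G (map (\<lambda>g. g [^]\<^bsub>G\<^esub> (2::nat)) gs @ cs) = \<one>\<^bsub>G\<^esub>})
       = of_nat (Coset.order G) ^ (k - 1) * (\<Prod>C\<leftarrow>Cs. of_nat (card C)) *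
         (\<Sum>\<chi>\<in>irreducible_characters G.
            frobenius_schur_indicator G \<chi> ^ k *
            ((\<Prod>C\<leftarrow>Cs. class_value \<chi> C) / \<chi> \<one>\<^bsub>G\<^esub> powi (int n + int k - 2)))"
proof -
  interpret finite_group G
    using assms(1,2) by (simp add: finite_group_def finite_group_axioms_def)
  let ?N = "of_nat (Coset.order G) :: complex" and ?I = "irreducible_characters G"
  let ?L = "listset (replicate k (carrier G))"
  let ?p = "\<lambda>gs cs. ordered_product G (map (\<lambda>g. g [^]\<^bsub>G\<^esub> (2::nat)) gs @ cs)"
  note Cs = assms(5)
  have p: "?p gs cs \<in> carrier G" if gs: "gs \<in> ?L" and cs: "cs \<in> listset Cs" for gs cs
  proof -
    have "set gs \<subseteq> carrier G" using listset_subset[OF gs, of "carrier G"] by (auto split: if_splits)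
    moreover have "set cs \<subseteq> carrier G"
      using listset_subset[OF cs, of "carrier G"] Cs conjugacy_class_subset by auto
    ultimately show ?thesis by (intro ordered_product_closed) auto
  qed
  have fin: "finite ?L" "finite (listset Cs)"
    using finite_carrier Cs conjugacy_class_subset
    by (auto intro!: finite_listset split: if_splits dest: finite_subset)
  have "of_nat (card {(gs, cs). gs \<in> ?L \<and> cs \<in> listset Cs \<and> ?p gs cs = \<one>\<^bsub>G\<^esub>})
      = (\<Sum>(gs, cs)\<in>?L \<times> listset Cs. if ?p gs cs = \<one>\<^bsub>G\<^esub> then 1 else 0 :: complex)"
    using fin by (simp add: sum.If_cases case_prod_unfold Int_def) (rule arg_cong[of _ _ card], auto)
  also have "\<dots> = (\<Sum>gs\<in>?L. \<Sum>cs\<in>listset Cs. if ?p gs cs = \<one>\<^bsub>G\<^esub> then 1 else 0)"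
    by (simp add: sum.cartesian_product)
  \<comment> \<open>The condition that the product be \<open>\<one>\<close> is detected by the
    regular character divided by |G|.\<close>
  also have "\<dots> = (\<Sum>gs\<in>?L. \<Sum>cs\<in>listset Cs. \<Sum>\<chi>\<in>?I. \<chi> \<one>\<^bsub>G\<^esub> / ?N * \<chi> (?p gs cs))"
  proof (intro sum.cong refl)
    fix gs cs assume "gs \<in> ?L" "cs \<in> listset Cs"
    have "(\<Sum>\<chi>\<in>?I. \<chi> \<one>\<^bsub>G\<^esub> / ?N * \<chi> (?p gs cs)) = (\<Sum>\<chi>\<in>?I. \<chi> \<one>\<^bsub>G\<^esub> * \<chi> (?p gs cs)) / ?N"
      by (simp add: sum_divide_distrib)
    then show "(if ?p gs cs = \<one>\<^bsub>G\<^esub> then 1 else 0) = (\<Sum>\<chi>\<in>?I. \<chi> \<one>\<^bsub>G\<^esub> / ?N * \<chi> (?p gs cs))"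
      using sum_irreducible_characters[OF p[OF \<open>gs \<in> ?L\<close> \<open>cs \<in> listset Cs\<close>]] by simp
  qed
  also have "\<dots> = (\<Sum>gs\<in>?L. \<Sum>\<chi>\<in>?I. \<Sum>cs\<in>listset Cs. \<chi> \<one>\<^bsub>G\<^esub> / ?N * \<chi> (?p gs cs))"
    by (intro sum.cong refl sum.swap)
  also have "\<dots> = (\<Sum>\<chi>\<in>?I. \<Sum>gs\<in>?L. \<Sum>cs\<in>listset Cs. \<chi> \<one>\<^bsub>G\<^esub> / ?N * \<chi> (?p gs cs))"
    by (rule sum.swap)
  also have "\<dots> = (\<Sum>\<chi>\<in>?I. ?N ^ (k - 1) * (\<Prod>C\<leftarrow>Cs. of_nat (card C)) *
      (frobenius_schur_indicator G \<chi> ^ k *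
        ((\<Prod>C\<leftarrow>Cs. class_value \<chi> C) / \<chi> \<one>\<^bsub>G\<^esub> powi (int n + int k - 2))))"
  proof (intro sum.cong refl)
    fix \<chi> assume \<chi>: "\<chi> \<in> ?I"
    let ?x = "\<chi> \<one>\<^bsub>G\<^esub>" and ?\<nu> = "frobenius_schur_indicator G \<chi>"
    have x: "?x \<noteq> 0" by (rule irreducible_character_one_nonzero[OF \<chi>])
    have split: "(\<Prod>C\<leftarrow>Cs. of_nat (card C) * class_value \<chi> C / ?x)
        = (\<Prod>C\<leftarrow>Cs. of_nat (card C)) * (\<Prod>C\<leftarrow>Cs. class_value \<chi> C) / ?x ^ n"
      unfolding assms(4)[symmetric] by (induction Cs) auto
    \<comment> \<open>The exponent is -1 for \<open>n = 0\<close> and \<open>k = 1\<close>, hence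
      \<open>powi\<close>; since \<open>?x\<close> is nonzero, it can be written as a quotient of
      natural powers.\<close>
    have "int n + int k - 2 = int (n + k) - int 2" by simp
    moreover have "?x powi (int (n + k) - int 2) = ?x ^ (n + k) / ?x ^ 2"
      using x by (subst power_int_diff) (simp, simp only: power_int_of_nat)
    ultimately have pow: "?x powi (int n + int k - 2) = ?x ^ (n + k) / ?x ^ 2" by (simp only:)
    \<comment> \<open>Since \<open>k \<ge> 1\<close>, a factor \<open>?N\<close> splits off and
      cancels the division by |G| in the weight of \<open>\<chi>\<close>.\<close>
    have Nk: "?N ^ k = ?N ^ (k - 1) * ?N"
      using power_minus_mult[of k ?N] assms(3) by simp
    have "(\<Sum>gs\<in>?L. \<Sum>cs\<in>listset Cs. ?x / ?N * \<chi> (?p gs cs))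
        = ?x / ?N * ((?N * ?\<nu> / ?x) ^ k * (\<Prod>C\<leftarrow>Cs. of_nat (card C) * class_value \<chi> C / ?x) * ?x)"
      unfolding sum_character_ordered_product[OF \<chi> Cs, symmetric] by (simp add: sum_distrib_left)
    \<comment> \<open>Of the two factors \<open>?x\<close> that form \<open>?x ^ 2\<close>, one is
      the multiplicity of \<open>\<chi>\<close> in the regular character and the other is left over
      from the sum over tuples.\<close>
    also have "\<dots> = ?N ^ (k - 1) * (\<Prod>C\<leftarrow>Cs. of_nat (card C)) *
        (?\<nu> ^ k * ((\<Prod>C\<leftarrow>Cs. class_value \<chi> C) / ?x powi (int n + int k - 2)))"
      unfolding split pow power_mult_distrib power_divide Nk
      using x by (simp add: field_simps power_add power2_eq_square)
    finally show "(\<Sum>gs\<in>?L. \<Sum>cs\<in>listset Cs. ?x / ?N * \<chi> (?p gs cs)) = \<dots>" .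
  qed
  finally show ?thesis by (simp add: sum_distrib_left)
qed

end
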